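(* Let $0<\alpha<2$, $\mathfrak{U}\in C^2(\mathbb{S}^1,(0,+\infty))$ and $U(x)=\mathfrak{U}(x/|x|)/|x|^{\alpha}$ on $\mathbb{R}^2\setminus\{0\}$. Let $x(t)=(r\cos\theta,r\sin\theta)(t)$ be a parabolic solution of $\ddot x=\nabla U(x)$ such that $\lim_{t\to\pm\infty}\theta(t)=\theta_0^{\pm}$, where $\theta_0^-$ and $\theta_0^+$ are non-degenerate global minimizers of $\mathfrak{U}$ (i.e. global minimizers with $\mathfrak{U}_{\theta\theta}(\theta_0^\pm)\ne0$). Then $m^-(x)=i(x)=0$.
   Context: Here $\mathbb{S}^1=[-\pi,\pi]/\{\pm\pi\}$; in polar coordinates $x=(r\cos\theta,r\sin\theta)$ the function $\mathfrak{U}$ is regarded as a function of $\theta\in\mathbb{S}^1$, and subscripts $\theta$ denote derivatives. A solution $x:(T^-,T^+)\to\mathbb{R}^2\setminus\{0\}$ is parabolic if $T^\pm=\pm\infty$, $\lim_{t\to\pm\infty}|x(t)|=+\infty$ and $\lim_{t\to\pm\infty}|\dot x(t)|=0$. A parabolic solution has zero energy ($\frac12|\dot x|^2-U(x)\equiv0$) and is never homothetic ($\theta(t)$ is not constant). Morse index. For $t_1<t_2$ let $\mathcal{F}(x;t_1,t_2)=\int_{t_1}^{t_2}\left(\frac12|\dot x|^2+U(x)\right)dt$, and let $m^-(x;t_1,t_2)$ be the dimension of the largest subspace of $W_0^{1,2}([t_1,t_2],\mathbb{R}^2)$ on which the second derivative $d^2\mathcal{F}(x;t_1,t_2)$ is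 negative definite. The Morse index of $x$ is $m^-(x)=\lim_{n\to\infty}m^-(x;t_n^-,t_n^+)$, where $t_n^-<t_n^+$ and $t_n^\pm\to T^\pm=\pm\infty$ (the limit is independent of the sequences, since $m^-(x;t_1,t_2)$ is monotone under inclusion of intervals). Oscillation index. For a non-homothetic solution $x$, $i(x)=\#\{t\in(T^-,T^+):\dot\theta(t)=0\}$. *)

theory Defs
  imports "HOL-Analysis.Analysis" "HOL-Library.Function_Algebras"
begin

section \<open>Homogeneous potentials in the plane\<close>

definition unit_vec :: "real \<Rightarrow> real^2" where
  "unit_vec \<phi> = vector [cos \<phi>, sin \<phi>]"

text \<open>
  The angular part of the potential is a function on the unit circle of the plane; only its
  values on \<^term>\<open>sphere 0 1 :: (real^2) set\<close> matter. Regarded as a function of the angle it is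
  the \<open>2\<pi>\<close>-periodic function \<open>angular V\<close>, and its regularity and its derivatives with respect
  to \<open>\<theta>\<close> are those of \<open>angular V\<close>.
\<close>

definition angular :: "(real^2 \<Rightarrow> real) \<Rightarrow> real \<Rightarrow> real" where
  "angular V \<phi> = V (unit_vec \<phi>)"

definition C2_on_circle :: "(real^2 \<Rightarrow> real) \<Rightarrow> bool" where
  "C2_on_circle V \<longleftrightarrow>
     (\<forall>\<phi>. angular V differentiable at \<phi>) \<and>
     (\<forall>\<phi>. deriv (angular V) differentiable at \<phi>) \<and>
     continuous_on UNIV (deriv (deriv (angular V)))"

definition nondegenerate_global_minimizer :: "(real^2 \<Rightarrow> real) \<Rightarrow> real \<Rightarrow> bool" where
  "nondegenerate_global_minimizer V \<phi>\<^sub>0 \<longleftrightarrow>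
     (\<forall>\<phi>. angular V \<phi>\<^sub>0 \<le> angular V \<phi>) \<and> deriv (deriv (angular V)) \<phi>\<^sub>0 \<noteq> 0"

definition potential :: "real \<Rightarrow> (real^2 \<Rightarrow> real) \<Rightarrow> real^2 \<Rightarrow> real" where
  "potential \<alpha> V x = V (x /\<^sub>R norm x) / norm x powr \<alpha>"

section \<open>Parabolic solutions\<close>

text \<open>Solutions of \<open>x'' = \<nabla>U(x)\<close>, without collisions, defined for all times.\<close>

definition global_solution :: "(real^2 \<Rightarrow> real) \<Rightarrow> (real \<Rightarrow> real^2) \<Rightarrow> bool" where
  "global_solution U x \<longleftrightarrow>
     (\<exists>v a. \<forall>t. x t \<noteq> 0 \<and>
        (x has_vector_derivative v t) (at t) \<and>
        (v has_vector_derivative a t) (at t) \<and>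
        GDERIV U (x t) :> a t)"

definition parabolic_solution :: "(real^2 \<Rightarrow> real) \<Rightarrow> (real \<Rightarrow> real^2) \<Rightarrow> bool" where
  "parabolic_solution U x \<longleftrightarrow>
     global_solution U x \<and>
     filterlim (\<lambda>t. norm (x t)) at_top at_top \<and>
     filterlim (\<lambda>t. norm (x t)) at_top at_bot \<and>
     ((\<lambda>t. norm (vector_derivative x (at t))) \<longlongrightarrow> 0) at_top \<and>
     ((\<lambda>t. norm (vector_derivative x (at t))) \<longlongrightarrow> 0) at_bot"

text \<open>
  The angle of a path is a continuous lift to the real line, hence determined up to a constant
  in \<open>2\<pi>\<int>\<close>. Convergence of the angle on the circle is equivalent to convergence of this lift.
\<close>

definition polar_coordinates ::
    "(real \<Rightarrow> real^2) \<Rightarrow> (real \<Rightarrow> real) \<Rightarrow> (real \<Rightarrow> real) \<Rightarrow> bool" where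
  "polar_coordinates x r \<theta> \<longleftrightarrow>
     continuous_on UNIV \<theta> \<and> (\<forall>t. r t > 0 \<and> x t = r t *\<^sub>R unit_vec (\<theta> t))"

definition oscillation_index :: "(real \<Rightarrow> real) \<Rightarrow> enat" where
  "oscillation_index \<theta> =
     (let Z = {t. (\<theta> has_real_derivative 0) (at t)}
      in if finite Z then enat (card Z) else \<infinity>)"

section \<open>Sobolev paths and the action functional\<close>

text \<open>
  In one dimension \<open>W\<^sup>1\<^sup>,\<^sup>2([a,b])\<close> consists of the indefinite integrals of
  square-integrable functions (the absolutely continuous representatives). The weak derivative is
  unique up to null sets, so the choice in \<open>weak_deriv\<close> does not affect integrals.
\<close>

definition has_weak_deriv ::
    "(real \<Rightarrow> real^2) \<Rightarrow> (real \<Rightarrow> real^2) \<Rightarrow> real \<Rightarrow> real \<Rightarrow> bool" where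
  "has_weak_deriv y g a b \<longleftrightarrow>
     set_integrable lborel {a..b} g \<and>
     set_integrable lborel {a..b} (\<lambda>t. (norm (g t))\<^sup>2) \<and>
     (\<forall>t\<in>{a..b}. y t = y a + (LINT s:{a..t}|lborel. g s))"

definition weak_deriv :: "(real \<Rightarrow> real^2) \<Rightarrow> real \<Rightarrow> real \<Rightarrow> real \<Rightarrow> real^2" where
  "weak_deriv y a b = (SOME g. has_weak_deriv y g a b)"

text \<open>
  Elements of \<open>W\<^sub>0\<^sup>1\<^sup>,\<^sup>2([a,b])\<close> are extended by zero outside \<open>[a,b]\<close>, so that
  distinct functions are distinct elements and dimensions of subspaces are meaningful.
\<close>

definition W0 :: "real \<Rightarrow> real \<Rightarrow> (real \<Rightarrow> real^2) set" where
  "W0 a b = {h. (\<exists>g. has_weak_deriv h g a b) \<and> h a = 0 \<and> h b = 0 \<and> (\<forall>t. t \<notin> {a..b} \<longrightarrow> h t = 0)}"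

definition action :: "(real^2 \<Rightarrow> real) \<Rightarrow> real \<Rightarrow> real \<Rightarrow> (real \<Rightarrow> real^2) \<Rightarrow> real" where
  "action U a b y =
     (LINT t:{a..b}|lborel. (norm (weak_deriv y a b t))\<^sup>2 / 2 + U (y t))"

text \<open>The second derivative \<open>d\<^sup>2F(x)[h,k]\<close> of the action as an iterated directional derivative.\<close>

definition action_deriv2 ::
    "(real^2 \<Rightarrow> real) \<Rightarrow> real \<Rightarrow> real \<Rightarrow> (real \<Rightarrow> real^2) \<Rightarrow> (real \<Rightarrow> real^2) \<Rightarrow> (real \<Rightarrow> real^2) \<Rightarrow> real"
  where
  "action_deriv2 U a b x h k =
     deriv (\<lambda>s. deriv (\<lambda>u. action U a b (\<lambda>t. x t + s *\<^sub>R h t + u *\<^sub>R k t)) 0) 0"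

section \<open>Morse index\<close>

global_interpretation curves: vector_space "\<lambda>(c::real) (h::real \<Rightarrow> real^2) t. c *\<^sub>R h t"
  by unfold_locales (auto simp: fun_eq_iff scaleR_add_right scaleR_add_left)

definition negative_definite_on ::
    "(real \<Rightarrow> real^2) set \<Rightarrow> ((real \<Rightarrow> real^2) \<Rightarrow> (real \<Rightarrow> real^2) \<Rightarrow> real) \<Rightarrow> bool" where
  "negative_definite_on E B \<longleftrightarrow> (\<forall>h\<in>E. h \<noteq> 0 \<longrightarrow> B h h < 0)"

text \<open>
  The library's \<open>dim\<close> is \<open>0\<close> on infinite-dimensional spaces, hence the restriction to
  finite-dimensional subspaces: the supremum is \<open>\<infinity>\<close> if the dimensions are unbounded.
\<close>

definition morse_index_on :: "(real^2 \<Rightarrow> real) \<Rightarrow> (real \<Rightarrow> real^2) \<Rightarrow> real \<Rightarrow> real \<Rightarrow> enat" where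
  "morse_index_on U x a b =
     Sup {enat (curves.dim E) | E.
            curves.subspace E \<and> E \<subseteq> W0 a b \<and>
            (\<exists>S. finite S \<and> E = curves.span S) \<and>
            negative_definite_on E (action_deriv2 U a b x)}"

definition has_morse_index :: "(real^2 \<Rightarrow> real) \<Rightarrow> (real \<Rightarrow> real^2) \<Rightarrow> enat \<Rightarrow> bool" where
  "has_morse_index U x m \<longleftrightarrow>
     (\<forall>tm tp :: nat \<Rightarrow> real.
        (\<forall>n. tm n < tp n) \<and> filterlim tm at_bot sequentially \<and> filterlim tp at_top sequentially
        \<longrightarrow> (\<lambda>n. morse_index_on U x (tm n) (tp n)) \<longlonglongrightarrow> m)"

end

theory Submission
  imports Defs
begin

text \<open>
  Let \<open>W\<close> be the potential as a function of the angle and \<open>c = r\<^sup>2 \<theta>'\<close>. McGehee's radial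
  velocity \<open>\<nu> = r\<^sup>\<alpha>\<^sup>/\<^sup>2 r'\<close> is nondecreasing on a zero energy solution, with
  \<open>\<nu>' = (1 - \<alpha>/2) r\<^sup>\<alpha>\<^sup>/\<^sup>2\<^sup>-\<^sup>3 c\<^sup>2\<close>, and \<open>\<nu>\<^sup>2 \<le> 2 W(\<theta>)\<close> with equality exactly where \<open>c = 0\<close>.
  As \<open>\<theta>\<close> tends to minimizers at both ends, \<open>\<nu>\<^sup>2 \<le> 2 min W\<close> at all times, so a zero of \<open>c\<close>
  would make \<open>\<nu>\<close> constant on a half line and the solution homothetic. Hence \<open>\<theta>'\<close> has no zeros.

  The Jacobi fields \<open>x'\<close> and \<open>2/(2+\<alpha>) x - t x'\<close> span a Lagrangian space, and their determinant is a
  multiple of \<open>c\<close>, so they define a global solution \<open>A\<close> of the Riccati equation \<open>A' + A\<^sup>2 = D\<^sup>2U(x)\<close>.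
  Completing the square, \<open>|h'|\<^sup>2 + D\<^sup>2U(x)[h,h] = |h' - A h|\<^sup>2 + (h \<cdot> A h)'\<close>, so the second variation is
  nonnegative on \<open>W\<^sub>0\<^sup>1\<^sup>,\<^sup>2\<close> over every interval.
\<close>

section \<open>Planar vectors, the potential in polar coordinates, and a Gronwall estimate\<close>

lemma inner_real2: "(y::real^2) \<bullet> z = y $ 1 * z $ 1 + y $ 2 * z $ 2"
  by (simp add: inner_vec_def sum_2)

lemma unit_vec_nth [simp]: "unit_vec \<phi> $ 1 = cos \<phi>" "unit_vec \<phi> $ 2 = sin \<phi>"
  by (simp_all add: unit_vec_def)

lemma norm_unit_vec [simp]: "norm (unit_vec \<phi>) = 1"
  by (simp add: norm_eq_sqrt_inner inner_real2 flip: power2_eq_square)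

lemma potential_polar:
  assumes "0 < \<rho>"
  shows "potential \<alpha> V (\<rho> *\<^sub>R unit_vec \<phi>) = angular V \<phi> * \<rho> powr - \<alpha>"
  using assms by (simp add: potential_def angular_def powr_minus field_simps)

text \<open>With \<open>k\<close> taken for the interval between \<open>t1\<close> and
  \<open>t\<close>, the function f(s) exp(-k s) is nonincreasing to the right of \<open>t1\<close>
  and f(s) exp(k s) is nondecreasing to the left. Both vanish at \<open>t1\<close>, so f is
  nonpositive at \<open>t\<close>. The constant may depend on the interval, since the equations of
  motion give only local bounds.\<close>

lemma gronwall_zero:
  fixes f f' :: "real \<Rightarrow> real"
  assumes f: "\<And>t. (f has_real_derivative f' t) (at t)"
    and nonneg: "\<And>t. 0 \<le> f t"
    and bound: "\<And>A B. \<exists>k. \<forall>t\<in>{A..B}. \<bar>f' t\<bar> \<le> k * f t"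
    and zero: "f t1 = 0"
  shows "f t = 0"
proof -
  obtain k where k: "\<And>s. s \<in> {min t t1..max t t1} \<Longrightarrow> \<bar>f' s\<bar> \<le> k * f s"
    using bound[of "min t t1" "max t t1"] by blast
  have "f t \<le> 0"
  proof (cases "t1 \<le> t")
    case True
    have "f t * exp (- k * t) \<le> f t1 * exp (- k * t1)"
    proof (rule DERIV_nonpos_imp_nonincreasing[OF True])
      fix s assume s: "t1 \<le> s" "s \<le> t"
      have "((\<lambda>t. f t * exp (- k * t)) has_real_derivative (f' s - k * f s) * exp (- k * s)) (at s)"
        by (auto intro!: derivative_eq_intros f simp: algebra_simps)
      moreover have "(f' s - k * f s) * exp (- k * s) \<le> 0"
        using k[of s] s by (intro mult_nonpos_nonneg) auto
      ultimately show "\<exists>y. ((\<lambda>t. f t * exp (- k * t)) has_real_derivative y) (at s) \<and> y \<le> 0"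
        by blast
    qed
    then show ?thesis by (simp add: zero mult_le_0_iff)
  next
    case False
    then have le: "t \<le> t1" by simp
    have "f t * exp (k * t) \<le> f t1 * exp (k * t1)"
    proof (rule DERIV_nonneg_imp_nondecreasing[OF le])
      fix s assume s: "t \<le> s" "s \<le> t1"
      have "((\<lambda>t. f t * exp (k * t)) has_real_derivative (f' s + k * f s) * exp (k * s)) (at s)"
        by (auto intro!: derivative_eq_intros f simp: algebra_simps)
      moreover have "0 \<le> (f' s + k * f s) * exp (k * s)"
        using k[of s] s by (intro mult_nonneg_nonneg) auto
      ultimately show "\<exists>y. ((\<lambda>t. f t * exp (k * t)) has_real_derivative y) (at s) \<and> 0 \<le> y"
        by blast
    qed
    then show ?thesis by (simp add: zero mult_le_0_iff)
  qed
  with nonneg[of t] show ?thesis by simp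
qed

section \<open>Absolutely continuous functions and weak derivatives\<close>

lemma set_integrable_continuous_mult:
  fixes f \<phi> :: "real \<Rightarrow> real"
  assumes "set_integrable lborel {a..b} f" "continuous_on {a..b} \<phi>"
  shows "set_integrable lborel {a..b} (\<lambda>t. \<phi> t * f t)"
proof -
  have "bounded (\<phi> ` {a..b})"
    using assms(2) by (intro compact_imp_bounded compact_continuous_image) auto
  then obtain M where M: "\<And>t. t \<in> {a..b} \<Longrightarrow> \<bar>\<phi> t\<bar> \<le> M"
    by (meson bounded_real imageI)
  have \<phi>: "(\<lambda>t. indicator {a..b} t *\<^sub>R \<phi> t) \<in> borel_measurable lborel"
    using borel_integrable_atLeastAtMost'[OF assms(2)] by (simp add: set_integrable_def)
  have f: "(\<lambda>t. indicator {a..b} t *\<^sub>R f t) \<in> borel_measurable lborel"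
    using assms(1) by (simp add: set_integrable_def)
  \<comment> \<open>Neither factor is known to be measurable outside the interval, so each receives
    its own indicator.\<close>
  have eq: "(\<lambda>t. indicator {a..b} t *\<^sub>R (\<phi> t * f t)) =
      (\<lambda>t. (indicator {a..b} t *\<^sub>R \<phi> t) * (indicator {a..b} t *\<^sub>R f t))"
    by (auto simp: indicator_def)
  show ?thesis unfolding set_integrable_def
  proof (rule Bochner_Integration.integrable_bound)
    show "integrable lborel (\<lambda>t. M *\<^sub>R (indicator {a..b} t *\<^sub>R f t))"
      using assms(1) by (simp add: set_integrable_def)
    show "(\<lambda>t. indicator {a..b} t *\<^sub>R (\<phi> t * f t)) \<in> borel_measurable lborel"
      unfolding eq by (intro borel_measurable_times \<phi> f)
    show "AE t in lborel. norm (indicator {a..b} t *\<^sub>R (\<phi> t * f t)) \<le> norm (M *\<^sub>R indicator {a..b} t *\<^sub>R f t)"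
      using M by (intro AE_I2) (fastforce simp: indicator_def abs_mult intro!: mult_right_mono)
  qed
qed

text \<open>Absolute continuity is encoded by the integral identity, the scalar counterpart of
  \<open>has_weak_deriv\<close> without square integrability. Products of such functions stay in the
  class, and boundary terms can be read off directly.\<close>

definition has_ac_deriv :: "(real \<Rightarrow> real) \<Rightarrow> (real \<Rightarrow> real) \<Rightarrow> real \<Rightarrow> real \<Rightarrow> bool" where
  "has_ac_deriv F f a b \<longleftrightarrow> set_integrable lborel {a..b} f \<and>
     (\<forall>t\<in>{a..b}. (LINT s:{a..t}|lborel. f s) = F t - F a)"

lemma set_integrable_Icc_subset:
  fixes f :: "real \<Rightarrow> 'a::{second_countable_topology, banach}"
  assumes "set_integrable lborel {a..b::real} f" "t \<le> b"
  shows "set_integrable lborel {a..t} f"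
  using assms by (intro set_integrable_subset[OF assms(1)]) auto

lemma has_ac_deriv_continuous:
  assumes "has_ac_deriv F f a b"
  shows "continuous_on {a..b} F"
proof -
  have f: "set_integrable lborel {a..b} f" and F: "\<And>t. t \<in> {a..b} \<Longrightarrow> (LINT s:{a..t}|lborel. f s) = F t - F a"
    using assms by (auto simp: has_ac_deriv_def)
  have "F a + integral {a..t} f = F t" if "t \<in> {a..b}" for t
    using set_borel_integral_eq_integral(2)[OF set_integrable_Icc_subset[OF f, of t]] F[OF that] that by simp
  moreover have "continuous_on {a..b} (\<lambda>t. F a + integral {a..t} f)"
    by (intro continuous_intros indefinite_integral_continuous_1 set_borel_integral_eq_integral f)
  ultimately show ?thesis by (rule continuous_on_eq[rotated])
qed

lemma has_ac_deriv_subset: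
  assumes "has_ac_deriv F f a b" "t \<in> {a..b}"
  shows "has_ac_deriv F f a t"
  using assms set_integrable_Icc_subset[of a b f t] by (auto simp: has_ac_deriv_def)

lemma has_ac_deriv_cong:
  assumes "has_ac_deriv F f a b" "\<And>t. t \<in> {a..b} \<Longrightarrow> f t = g t"
  shows "has_ac_deriv F g a b"
proof -
  have "set_integrable lborel {a..b} g"
    using assms by (subst set_integrable_cong[of lborel lborel _ _ _ f]) (auto simp: has_ac_deriv_def)
  moreover have "(LINT s:{a..t}|lborel. g s) = (LINT s:{a..t}|lborel. f s)" if "t \<in> {a..b}" for t
    using that assms(2) by (intro set_lebesgue_integral_cong) auto
  ultimately show ?thesis using assms(1) by (simp add: has_ac_deriv_def)
qed

lemma has_ac_deriv_add:
  assumes "has_ac_deriv F f a b" "has_ac_deriv G g a b"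
  shows "has_ac_deriv (\<lambda>t. F t + G t) (\<lambda>t. f t + g t) a b"
proof -
  have int: "set_integrable lborel {a..t} f" "set_integrable lborel {a..t} g" if "t \<in> {a..b}" for t
    using assms that by (auto simp: has_ac_deriv_def intro: set_integrable_Icc_subset)
  show ?thesis
    using assms unfolding has_ac_deriv_def
    by (auto simp: set_integral_add int intro!: set_integral_add)
qed

lemma has_ac_deriv_C1:
  assumes F: "\<And>t. (F has_real_derivative f t) (at t)" and f: "continuous_on {a..b} f"
  shows "has_ac_deriv F f a b"
proof -
  have int: "set_integrable lborel {a..b} f"
    using f by (rule borel_integrable_atLeastAtMost')
  have "(LINT s:{a..t}|lborel. f s) = F t - F a" if t: "t \<in> {a..b}" for t
  proof -
    have "(LINT s:{a..t}|lborel. f s) = integral {a..t} f"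
      using t by (intro set_borel_integral_eq_integral set_integrable_Icc_subset[OF int]) auto
    also have "\<dots> = F t - F a"
      using t F by (intro integral_unique fundamental_theorem_of_calculus)
        (auto simp flip: has_real_derivative_iff_has_vector_derivative intro: has_field_derivative_at_within)
    finally show ?thesis .
  qed
  then show ?thesis using int by (simp add: has_ac_deriv_def)
qed

section \<open>Integration by parts and the product rule\<close>

text \<open>Fubini over the square \<open>[a,b]\<^sup>2\<close>, cut along the diagonal.\<close>

lemma has_ac_deriv_by_parts:
  assumes F: "has_ac_deriv F f a b" and G: "has_ac_deriv G g a b" and "a \<le> b"
  shows "(LINT s:{a..b}|lborel. F s * g s + G s * f s) = F b * G b - F a * G a"
proof -

  have fi: "set_integrable lborel {a..b} f" and gi: "set_integrable lborel {a..b} g"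
    using F G by (auto simp: has_ac_deriv_def)
  define f' where "f' s = indicator {a..b} s *\<^sub>R f s" for s
  define g' where "g' s = indicator {a..b} s *\<^sub>R g s" for s
  have f': "integrable lborel f'" and g': "integrable lborel g'"
    using fi gi by (simp_all add: f'_def[abs_def] g'_def[abs_def] set_integrable_def)
  have [measurable]: "f' \<in> borel_measurable lborel" "g' \<in> borel_measurable lborel"
    using f' g' by auto
  have prod: "integrable (lborel \<Otimes>\<^sub>M lborel) (\<lambda>(s, u). f' s * g' u)"
  proof (rule lborel_pair.Fubini_integrable)
    show "integrable lborel (\<lambda>s. LINT u|lborel. norm (case (s, u) of (s, u) \<Rightarrow> f' s * g' u))"
      using f' by (simp add: abs_mult)
    show "AE s in lborel. integrable lborel (\<lambda>u. case (s, u) of (s, u) \<Rightarrow> f' s * g' u)"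
      using g' by simp
  qed measurable
  define A where "A = (\<lambda>(s, u). if u \<le> s then f' s * g' u else 0)"
  define B where "B = (\<lambda>(s, u). if u \<le> s then 0 else f' s * g' u)"
  have A: "integrable (lborel \<Otimes>\<^sub>M lborel) A"
  proof (rule Bochner_Integration.integrable_bound[OF prod])
    show "A \<in> borel_measurable (lborel \<Otimes>\<^sub>M lborel)" unfolding A_def by measurable
  qed (auto simp: A_def)
  have B: "integrable (lborel \<Otimes>\<^sub>M lborel) B"
  proof (rule Bochner_Integration.integrable_bound[OF prod])
    show "B \<in> borel_measurable (lborel \<Otimes>\<^sub>M lborel)" unfolding B_def by measurable
  qed (auto simp: B_def)
  have F': "(LINT s|lborel. (if s < u then f' s else 0)) = F u - F a" if "u \<in> {a..b}" for u
  proof -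
    have "(LINT s|lborel. (if s < u then f' s else 0)) = (LINT s:{a..u}|lborel. f s)"
      unfolding set_lebesgue_integral_def
    proof (rule integral_cong_AE)
      \<comment> \<open>The diagonal belongs to \<open>A\<close>, so the inner integral of
        \<open>B\<close> runs over s < u; adding the single point \<open>u\<close> changes
        nothing.\<close>
      show "AE s in lborel. (if s < u then f' s else 0) = indicator {a..u} s *\<^sub>R f s"
        by (rule AE_mp[OF AE_lborel_singleton[of u] AE_I2]) (use that in \<open>auto simp: f'_def indicator_def\<close>)
      show "(\<lambda>s. indicator {a..u} s *\<^sub>R f s) \<in> borel_measurable lborel"
        using set_integrable_Icc_subset[OF fi, of u] that by (auto simp: set_integrable_def)
    qed measurable
    then show ?thesis using F that by (auto simp: has_ac_deriv_def)
  qed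
  have G': "(LINT u|lborel. (if u \<le> s then g' u else 0)) = G s - G a" if "s \<in> {a..b}" for s
  proof -
    have "(LINT u|lborel. (if u \<le> s then g' u else 0)) = (LINT u:{a..s}|lborel. g u)"
      unfolding set_lebesgue_integral_def
      using that by (intro Bochner_Integration.integral_cong) (auto simp: g'_def indicator_def)
    then show ?thesis using G that by (auto simp: has_ac_deriv_def)
  qed
  have "integral\<^sup>L (lborel \<Otimes>\<^sub>M lborel) A = (LINT s|lborel. LINT u|lborel. A (s, u))"
    using lborel_pair.integral_fst'[OF A] by simp
  also have "\<dots> = (LINT s|lborel. f' s * (LINT u|lborel. (if u \<le> s then g' u else 0)))"
    unfolding integral_mult_right_zero[symmetric]
    by (intro Bochner_Integration.integral_cong) (auto simp: A_def)
  also have "\<dots> = (LINT s:{a..b}|lborel. (G s - G a) * f s)"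
    unfolding set_lebesgue_integral_def
    by (intro Bochner_Integration.integral_cong) (auto simp: f'_def G' indicator_def)
  finally have intA: "integral\<^sup>L (lborel \<Otimes>\<^sub>M lborel) A = (LINT s:{a..b}|lborel. (G s - G a) * f s)" .
  have "integral\<^sup>L (lborel \<Otimes>\<^sub>M lborel) B = (LINT u|lborel. LINT s|lborel. B (s, u))"
    using lborel_pair.integral_snd[of "\<lambda>s u. B (s, u)"] B by (simp add: case_prod_unfold)
  also have "\<dots> = (LINT u|lborel. g' u * (LINT s|lborel. (if s < u then f' s else 0)))"
    unfolding integral_mult_right_zero[symmetric]
    by (intro Bochner_Integration.integral_cong) (auto simp: B_def)
  also have "\<dots> = (LINT u:{a..b}|lborel. (F u - F a) * g u)"
    unfolding set_lebesgue_integral_def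
    by (intro Bochner_Integration.integral_cong) (auto simp: g'_def F' indicator_def)
  finally have intB: "integral\<^sup>L (lborel \<Otimes>\<^sub>M lborel) B = (LINT u:{a..b}|lborel. (F u - F a) * g u)" .
  have "(LINT s:{a..b}|lborel. f s) * (LINT u:{a..b}|lborel. g u) = (LINT s|lborel. LINT u|lborel. f' s * g' u)"
    by (simp add: set_lebesgue_integral_def f'_def g'_def)
  also have "\<dots> = integral\<^sup>L (lborel \<Otimes>\<^sub>M lborel) (\<lambda>z. A z + B z)"
    unfolding lborel_pair.integral_fst[OF prod]
    by (intro Bochner_Integration.integral_cong) (auto simp: A_def B_def)
  also have "\<dots> = (LINT s:{a..b}|lborel. (G s - G a) * f s) + (LINT u:{a..b}|lborel. (F u - F a) * g u)"
    by (simp add: A B intA intB)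
  finally have eq: "(F b - F a) * (G b - G a) =
      (LINT s:{a..b}|lborel. (G s - G a) * f s) + (LINT u:{a..b}|lborel. (F u - F a) * g u)"
    using F G \<open>a \<le> b\<close> by (simp add: has_ac_deriv_def)
  have int: "set_integrable lborel {a..b} (\<lambda>s. G s * f s)" "set_integrable lborel {a..b} (\<lambda>s. F s * g s)"
    using fi gi has_ac_deriv_continuous[OF F] has_ac_deriv_continuous[OF G]
    by (auto intro: set_integrable_continuous_mult)
  have "(LINT s:{a..b}|lborel. (G s - G a) * f s) = (LINT s:{a..b}|lborel. G s * f s) - G a * (F b - F a)"
    using F \<open>a \<le> b\<close> int fi by (simp add: left_diff_distrib has_ac_deriv_def)
  moreover have "(LINT s:{a..b}|lborel. (F s - F a) * g s) = (LINT s:{a..b}|lborel. F s * g s) - F a * (G b - G a)"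
    using G \<open>a \<le> b\<close> int gi by (simp add: left_diff_distrib has_ac_deriv_def)
  ultimately show ?thesis using eq int by (simp add: algebra_simps)
qed

text \<open>Integration by parts applied on every initial segment [a, t].\<close>

lemma has_ac_deriv_mult:
  assumes F: "has_ac_deriv F f a b" and G: "has_ac_deriv G g a b"
  shows "has_ac_deriv (\<lambda>t. F t * G t) (\<lambda>t. F t * g t + G t * f t) a b"
proof -
  have "set_integrable lborel {a..b} (\<lambda>t. F t * g t + G t * f t)"
    using F G has_ac_deriv_continuous[OF F] has_ac_deriv_continuous[OF G]
    by (auto simp: has_ac_deriv_def intro!: set_integral_add set_integrable_continuous_mult)
  moreover have "(LINT s:{a..t}|lborel. F s * g s + G s * f s) = F t * G t - F a * G a" if "t \<in> {a..b}" for t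
    using has_ac_deriv_by_parts[OF has_ac_deriv_subset[OF F that] has_ac_deriv_subset[OF G that]] that
    by simp
  ultimately show ?thesis by (simp add: has_ac_deriv_def)
qed

section \<open>Uniqueness of weak derivatives\<close>

text \<open>The sets over which \<open>f\<close> and \<open>g\<close> have equal integrals form a Dynkin system.\<close>

lemma AE_eq_if_indefinite_integrals_eq:
  fixes f g :: "real \<Rightarrow> 'a::{second_countable_topology, banach}"
  assumes f: "set_integrable lborel {a..b} f" and g: "set_integrable lborel {a..b} g" and "a \<le> b"
    and eq: "\<And>t. t \<in> {a..b} \<Longrightarrow> (LINT s:{a..t}|lborel. f s) = (LINT s:{a..t}|lborel. g s)"
  shows "AE t in lborel. t \<in> {a..b} \<longrightarrow> f t = g t"
proof -
  define d where "d t = indicator {a..b} t *\<^sub>R (f t - g t)" for t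
  have d: "integrable lborel d"
    using set_integral_diff(1)[OF f g] by (simp add: d_def[abs_def] set_integrable_def)
  have dA: "set_integrable lborel A d" if "A \<in> sets borel" for A
    using that d unfolding set_integrable_def by (intro integrable_mult_indicator) auto
  have total: "(LINT t:UNIV|lborel. d t) = 0"
  proof -
    have "(LINT t:UNIV|lborel. d t) = (LINT s:{a..b}|lborel. f s - g s)"
      by (simp add: set_lebesgue_integral_def d_def)
    then show ?thesis using eq[of b] f g \<open>a \<le> b\<close> by (simp add: set_integral_diff)
  qed
  have "(LINT t:A|lborel. d t) = 0" if "A \<in> sets borel" for A
  proof -
    have "A \<in> sigma_sets UNIV (range (\<lambda>t::real. {..t}))"
      using that unfolding borel_eq_atMost by simp
    have "Int_stable (range (\<lambda>t::real. {..t}))" "range (\<lambda>t::real. {..t}) \<subseteq> Pow UNIV"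
      by (auto simp: Int_stable_def)
    from this \<open>A \<in> sigma_sets UNIV _\<close> show ?thesis
    proof (induction rule: sigma_sets_induct_disjoint)
      case (basic A)
      then obtain t where A: "A = {..t}" by blast
      show ?case
      proof (cases "t < a")
        case True
        then have "(LINT t:A|lborel. d t) = (LINT t|(lborel :: real measure). 0)"
          unfolding set_lebesgue_integral_def A
          by (intro Bochner_Integration.integral_cong) (auto simp: d_def indicator_def)
        then show ?thesis by simp
      next
        case False
        \<comment> \<open>As \<open>d\<close> vanishes off [a, b], a half line ending at t
          contributes only the segment from a to min t b, where the hypothesis applies.\<close>
        let ?t = "min t b"
        have t: "?t \<in> {a..b}" using False \<open>a \<le> b\<close> by auto
        have "(LINT s:A|lborel. d s) = (LINT s:{a..?t}|lborel. f s - g s)"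
          unfolding set_lebesgue_integral_def A
          by (intro Bochner_Integration.integral_cong) (auto simp: d_def indicator_def)
        also have "\<dots> = (LINT s:{a..?t}|lborel. f s) - (LINT s:{a..?t}|lborel. g s)"
          using t by (intro set_integral_diff set_integrable_Icc_subset[OF f] set_integrable_Icc_subset[OF g]) auto
        finally show ?thesis using eq[OF t] by simp
      qed
    next
      case empty
      show ?case by (simp add: set_lebesgue_integral_def)
    next
      case (compl A)
      then have A: "A \<in> sets borel" unfolding borel_eq_atMost by simp
      have "(LINT t:A \<union> (UNIV - A)|lborel. d t) = (LINT t:A|lborel. d t) + (LINT t:UNIV - A|lborel. d t)"
        using A by (intro set_integral_Un dA) auto
      then show ?case using compl total by simp
    next
      case (union A)
      then have A: "A i \<in> sets borel" for i unfolding borel_eq_atMost by auto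
      have "(LINT t:(\<Union>i. A i)|lborel. d t) = (\<Sum>i. (LINT t:A i|lborel. d t))"
        using A union(1) by (intro lebesgue_integral_countable_add dA) (auto simp: disjoint_family_on_def)
      then show ?case using union by simp
    qed
  qed
  then have "AE t in lborel. d t = 0"
    using sigma_finite_measure.density_zero[OF sigma_finite_lborel d] by simp
  then show ?thesis by eventually_elim (auto simp: d_def)
qed

lemma has_weak_deriv_nth:
  assumes h: "has_weak_deriv h g a b"
  shows "has_ac_deriv (\<lambda>t. h t $ i) (\<lambda>t. g t $ i) a b"
  unfolding has_ac_deriv_def
proof (intro conjI ballI)
  have g: "set_integrable lborel {a..b} g" using h by (simp add: has_weak_deriv_def)
  have comp: "set_integrable lborel {a..t} (\<lambda>s. g s $ i) \<and>
      (LINT s:{a..t}|lborel. g s $ i) = (LINT s:{a..t}|lborel. g s) $ i" if "t \<le> b" for t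
    using integrable_bounded_linear[OF bounded_linear_vec_nth[of i], of lborel "\<lambda>s. indicator {a..t} s *\<^sub>R g s"]
      integral_bounded_linear[OF bounded_linear_vec_nth[of i], of lborel "\<lambda>s. indicator {a..t} s *\<^sub>R g s"]
      set_integrable_Icc_subset[OF g that]
    by (simp add: set_integrable_def set_lebesgue_integral_def)
  show "set_integrable lborel {a..b} (\<lambda>t. g t $ i)" using comp by blast
  fix t assume t: "t \<in> {a..b}"
  then have "h t = h a + (LINT s:{a..t}|lborel. g s)" using h unfolding has_weak_deriv_def by blast
  then have "h t $ i = h a $ i + (LINT s:{a..t}|lborel. g s) $ i" by (metis vector_add_component)
  then show "(LINT s:{a..t}|lborel. g s $ i) = h t $ i - h a $ i"
    using comp[of t] t by simp
qed

section \<open>The action along a line of perturbed paths\<close>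

lemma DERIV_integral_parameter:
  fixes f f' :: "real \<Rightarrow> real \<Rightarrow> real"
  assumes I: "open I" "convex I" "w \<in> I"
    and D: "\<And>w t. w \<in> I \<Longrightarrow> t \<in> {a..b} \<Longrightarrow> ((\<lambda>w. f w t) has_real_derivative f' w t) (at w)"
    and f: "\<And>w. w \<in> I \<Longrightarrow> continuous_on {a..b} (f w)"
    and f': "continuous_on (I \<times> {a..b}) (\<lambda>(w, t). f' w t)"
  shows "((\<lambda>w. integral {a..b} (f w)) has_real_derivative integral {a..b} (f' w)) (at w)"
proof -
  have "((\<lambda>w. integral (cbox a b) (f w)) has_real_derivative integral (cbox a b) (f' w)) (at w within I)"
  proof (rule leibniz_rule_field_derivative)
    fix w t assume "w \<in> I" "t \<in> cbox a b"
    then show "((\<lambda>w. f w t) has_real_derivative f' w t) (at w within I)"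
      unfolding box_real by (intro has_field_derivative_at_within[OF D])
  next
    fix w assume "w \<in> I"
    then show "f w integrable_on cbox a b"
      unfolding box_real by (rule integrable_continuous_interval[OF f])
  next
    show "continuous_on (I \<times> cbox a b) (\<lambda>(w, t). f' w t)"
      unfolding box_real by (rule f')
  qed (fact I)+
  \<comment> \<open>The Leibniz rule differentiates within \<open>I\<close>; as \<open>I\<close> is
    open this is the ordinary derivative.\<close>
  then show ?thesis unfolding box_real at_within_open[OF I(3,1)] .
qed

lemma has_weak_deriv_C1:
  assumes y: "\<And>t. (y has_vector_derivative y' t) (at t)" and y': "continuous_on {a..b} y'"
  shows "has_weak_deriv y y' a b"
proof -
  have int: "set_integrable lborel {a..b} y'" "set_integrable lborel {a..b} (\<lambda>t. (norm (y' t))\<^sup>2)"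
    by (intro borel_integrable_atLeastAtMost' continuous_intros y')+
  have "y t = y a + (LINT s:{a..t}|lborel. y' s)" if t: "t \<in> {a..b}" for t
  proof -
    have "(LINT s:{a..t}|lborel. y' s) = integral {a..t} y'"
      using t by (intro set_borel_integral_eq_integral set_integrable_Icc_subset[OF int(1)]) auto
    also have "\<dots> = y t - y a"
      using t y by (intro integral_unique fundamental_theorem_of_calculus)
        (auto intro: has_vector_derivative_at_within)
    finally show ?thesis by simp
  qed
  then show ?thesis using int unfolding has_weak_deriv_def by blast
qed

lemma has_weak_deriv_integrable:
  assumes "has_weak_deriv y g a b"
  shows "set_integrable lborel {a..b} g" "set_integrable lborel {a..b} (\<lambda>t. (norm (g t))\<^sup>2)"
  using assms unfolding has_weak_deriv_def by blast+

lemma set_integrable_inner: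
  assumes y: "continuous_on {a..b} y'" and h: "has_weak_deriv h g a b"
  shows "set_integrable lborel {a..b} (\<lambda>t. y' t \<bullet> g t)"
  unfolding inner_real2
  using has_weak_deriv_nth[OF h]
  by (intro set_integral_add set_integrable_continuous_mult continuous_intros y)
     (auto simp: has_ac_deriv_def)

lemma norm_perturb:
  fixes y g :: "'a::real_inner"
  shows "(norm (y + w *\<^sub>R g))\<^sup>2 = (norm y)\<^sup>2 + (2 * w) * (y \<bullet> g) + w\<^sup>2 * (norm g)\<^sup>2"
  unfolding power2_norm_eq_inner
  by (simp add: inner_add_left inner_add_right inner_commute power2_eq_square algebra_simps)

text \<open>Expanding the square leaves the cross term y' . g, integrable because y' is continuous
  and g is integrable.\<close>

lemma has_weak_deriv_perturb:
  assumes y: "has_weak_deriv y y' a b" "continuous_on {a..b} y'" and h: "has_weak_deriv h g a b"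
  shows "has_weak_deriv (\<lambda>t. y t + w *\<^sub>R h t) (\<lambda>t. y' t + w *\<^sub>R g t) a b"
  unfolding has_weak_deriv_def
proof (intro conjI ballI)
  have int: "set_integrable lborel {a..b} y'" "set_integrable lborel {a..b} g"
    "set_integrable lborel {a..b} (\<lambda>t. (norm (y' t))\<^sup>2)" "set_integrable lborel {a..b} (\<lambda>t. (norm (g t))\<^sup>2)"
    using y h by (auto intro: has_weak_deriv_integrable)
  show "set_integrable lborel {a..b} (\<lambda>t. y' t + w *\<^sub>R g t)"
    by (intro set_integral_add set_integrable_scaleR_right int)
  show "set_integrable lborel {a..b} (\<lambda>t. (norm (y' t + w *\<^sub>R g t))\<^sup>2)"
    unfolding norm_perturb by (intro set_integral_add set_integrable_mult_right int set_integrable_inner[OF y(2) h])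
  fix t assume t: "t \<in> {a..b}"
  have "y t = y a + (LINT s:{a..t}|lborel. y' s)" "h t = h a + (LINT s:{a..t}|lborel. g s)"
    using y h t unfolding has_weak_deriv_def by blast+
  moreover have "(LINT s:{a..t}|lborel. y' s + w *\<^sub>R g s)
      = (LINT s:{a..t}|lborel. y' s) + w *\<^sub>R (LINT s:{a..t}|lborel. g s)"
    using t set_integrable_Icc_subset[OF int(1), of t] set_integrable_Icc_subset[OF int(2), of t]
    by (simp add: set_integral_add)
  ultimately show "y t + w *\<^sub>R h t = y a + w *\<^sub>R h a + (LINT s:{a..t}|lborel. y' s + w *\<^sub>R g s)"
    by (simp add: scaleR_add_right)
qed

text \<open>The derivative picked by \<open>SOME\<close> and the given one have the same indefinite
  integrals, hence agree almost everywhere. The action may therefore be computed with any explicit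
  weak derivative.\<close>

lemma weak_deriv_AE:
  assumes "has_weak_deriv y y' a b" "a \<le> b"
  shows "has_weak_deriv y (weak_deriv y a b) a b"
    and "AE t in lborel. t \<in> {a..b} \<longrightarrow> weak_deriv y a b t = y' t"
proof -
  show D: "has_weak_deriv y (weak_deriv y a b) a b"
    unfolding weak_deriv_def
    by (rule someI[of "\<lambda>k. has_weak_deriv y k a b", OF assms(1)])
  have "y t = y a + (LINT s:{a..t}|lborel. y' s)"
    "y t = y a + (LINT s:{a..t}|lborel. weak_deriv y a b s)" if "t \<in> {a..b}" for t
    using assms D that unfolding has_weak_deriv_def by blast+
  then have "(LINT s:{a..t}|lborel. weak_deriv y a b s) = (LINT s:{a..t}|lborel. y' s)" if "t \<in> {a..b}" for t
    using that by (metis add_left_cancel)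
  then show "AE t in lborel. t \<in> {a..b} \<longrightarrow> weak_deriv y a b t = y' t"
    using assms D by (intro AE_eq_if_indefinite_integrals_eq) (auto intro: has_weak_deriv_integrable)
qed

text \<open>The kinetic part is a quadratic polynomial in \<open>w\<close>, so that only the
  integral of the potential calls for differentiation under the integral sign.\<close>

lemma action_perturb:
  assumes y: "has_weak_deriv y y' a b" "continuous_on {a..b} y'" and h: "has_weak_deriv h g a b"
    and "a \<le> b" and U: "continuous_on {a..b} (\<lambda>t. U (y t + w *\<^sub>R h t))"
  shows "action U a b (\<lambda>t. y t + w *\<^sub>R h t) = (LINT t:{a..b}|lborel. (norm (y' t))\<^sup>2) / 2
      + w * (LINT t:{a..b}|lborel. y' t \<bullet> g t) + w\<^sup>2 / 2 * (LINT t:{a..b}|lborel. (norm (g t))\<^sup>2)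
      + integral {a..b} (\<lambda>t. U (y t + w *\<^sub>R h t))"
proof -
  let ?z = "\<lambda>t. y t + w *\<^sub>R h t"
  have z: "has_weak_deriv ?z (\<lambda>t. y' t + w *\<^sub>R g t) a b"
    by (rule has_weak_deriv_perturb[OF y h])
  note wd = weak_deriv_AE[OF z \<open>a \<le> b\<close>]
  have Ui: "set_integrable lborel {a..b} (\<lambda>t. U (?z t))"
    by (rule borel_integrable_atLeastAtMost'[OF U])
  have int: "set_integrable lborel {a..b} (\<lambda>t. (norm (y' t))\<^sup>2)" "set_integrable lborel {a..b} (\<lambda>t. (norm (g t))\<^sup>2)"
    "set_integrable lborel {a..b} (\<lambda>t. y' t \<bullet> g t)"
    using y h set_integrable_inner[OF y(2) h] by (auto intro: has_weak_deriv_integrable)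
  have half: "set_integrable lborel {a..b} (\<lambda>t. (norm (k t))\<^sup>2 / 2 + U (?z t))" if "has_weak_deriv ?z k a b" for k
    using that by (intro set_integral_add Ui set_integrable_divide has_weak_deriv_integrable)
  have "action U a b ?z = (LINT t:{a..b}|lborel. (norm (y' t + w *\<^sub>R g t))\<^sup>2 / 2 + U (?z t))"
    unfolding action_def set_lebesgue_integral_def
  proof (rule integral_cong_AE)
    show "AE t in lborel. indicator {a..b} t *\<^sub>R ((norm (weak_deriv ?z a b t))\<^sup>2 / 2 + U (?z t))
        = indicator {a..b} t *\<^sub>R ((norm (y' t + w *\<^sub>R g t))\<^sup>2 / 2 + U (?z t))"
      using wd(2) by eventually_elim (auto simp: indicator_def)
  qed (use half[OF wd(1)] half[OF z] in \<open>auto simp: set_integrable_def\<close>)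
  also have "\<dots> = (LINT t:{a..b}|lborel. (norm (y' t))\<^sup>2 / 2 + w * (y' t \<bullet> g t) + w\<^sup>2 / 2 * (norm (g t))\<^sup>2 + U (?z t))"
    by (intro set_lebesgue_integral_cong)
       (auto simp: norm_perturb field_simps)
  also have "\<dots> = (LINT t:{a..b}|lborel. (norm (y' t))\<^sup>2) / 2
      + w * (LINT t:{a..b}|lborel. y' t \<bullet> g t) + w\<^sup>2 / 2 * (LINT t:{a..b}|lborel. (norm (g t))\<^sup>2)
      + (LINT t:{a..b}|lborel. U (?z t))"
    by (simp only: set_integral_add set_integrable_divide set_integrable_mult_right int Ui
        set_integral_divide_zero set_integral_mult_right)
  finally show ?thesis by (simp add: set_borel_integral_eq_integral(2)[OF Ui])
qed

section \<open>Motion in polar coordinates\<close>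

locale kepler_motion =
  fixes \<alpha> :: real and V :: "real^2 \<Rightarrow> real" and x v a :: "real \<Rightarrow> real^2" and r \<theta> :: "real \<Rightarrow> real"
  assumes alpha: "0 < \<alpha>" "\<alpha> < 2"
    and C2: "C2_on_circle V"
    and x_deriv: "\<And>t. (x has_vector_derivative v t) (at t)"
    and v_deriv: "\<And>t. (v has_vector_derivative a t) (at t)"
    and gradient: "\<And>t. GDERIV (potential \<alpha> V) (x t) :> a t"
    and polar: "polar_coordinates x r \<theta>"
begin

definition W where "W = angular V"
definition W1 where "W1 = deriv W"
definition W2 where "W2 = deriv W1"

text \<open>\<open>p\<close> is half the derivative of |x|^2, that is r r', and \<open>c\<close> is
  the angular momentum.\<close>

definition p where "p t = x t \<bullet> v t"
definition c where "c t = x t $ 1 * v t $ 2 - x t $ 2 * v t $ 1"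

lemma W_deriv: "(W has_real_derivative W1 \<phi>) (at \<phi>)"
  using C2 unfolding C2_on_circle_def W_def W1_def
  by (simp add: DERIV_deriv_iff_real_differentiable)

lemma W1_deriv: "(W1 has_real_derivative W2 \<phi>) (at \<phi>)"
  using C2 unfolding C2_on_circle_def W_def W1_def W2_def
  by (simp add: DERIV_deriv_iff_real_differentiable)

lemma W2_cont: "continuous_on UNIV W2"
  using C2 unfolding C2_on_circle_def W_def W1_def W2_def by simp

lemma W_cont: "continuous_on S W"
  by (meson DERIV_isCont W_deriv continuous_at_imp_continuous_on)

lemma W1_cont: "continuous_on S W1"
  by (meson DERIV_isCont W1_deriv continuous_at_imp_continuous_on)

lemma r_pos: "0 < r t" and x_polar: "x t = r t *\<^sub>R unit_vec (\<theta> t)"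
  using polar by (simp_all add: polar_coordinates_def)

lemma theta_cont: "continuous_on S \<theta>"
  using polar continuous_on_subset by (auto simp: polar_coordinates_def)

lemma x_nth: "x t $ 1 = r t * cos (\<theta> t)" "x t $ 2 = r t * sin (\<theta> t)"
  by (simp_all add: x_polar)

lemma r_eq_norm: "r t = norm (x t)"
  using r_pos[of t] by (simp add: x_polar)

section \<open>Derivatives of the polar coordinates\<close>

lemma x_nth_deriv: "((\<lambda>t. x t $ i) has_real_derivative v t $ i) (at t)"
  using bounded_linear.has_vector_derivative[OF bounded_linear_vec_nth x_deriv]
  by (simp add: has_real_derivative_iff_has_vector_derivative)

lemma v_nth_deriv: "((\<lambda>t. v t $ i) has_real_derivative a t $ i) (at t)"
  using bounded_linear.has_vector_derivative[OF bounded_linear_vec_nth v_deriv]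
  by (simp add: has_real_derivative_iff_has_vector_derivative)

lemma r_sq: "(r t)\<^sup>2 = (x t $ 1)\<^sup>2 + (x t $ 2)\<^sup>2"
proof -
  have "(r t)\<^sup>2 = (r t)\<^sup>2 * ((cos (\<theta> t))\<^sup>2 + (sin (\<theta> t))\<^sup>2)" by simp
  then show ?thesis by (simp add: x_nth power_mult_distrib algebra_simps del: sin_cos_squared_add2)
qed

lemma r_deriv: "(r has_real_derivative p t / r t) (at t)"
proof -
  have r: "r = (\<lambda>t. sqrt ((x t $ 1)\<^sup>2 + (x t $ 2)\<^sup>2))"
    using r_pos by (simp add: fun_eq_iff less_imp_le flip: r_sq)
  have pos: "0 < (x t $ 1)\<^sup>2 + (x t $ 2)\<^sup>2" using r_pos[of t] by (simp flip: r_sq)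
  have "((\<lambda>t. sqrt ((x t $ 1)\<^sup>2 + (x t $ 2)\<^sup>2)) has_real_derivative
      p t / sqrt ((x t $ 1)\<^sup>2 + (x t $ 2)\<^sup>2)) (at t)"
    using pos by (auto intro!: derivative_eq_intros x_nth_deriv simp: p_def inner_real2 divide_simps)
  then show ?thesis unfolding r .
qed

text \<open>The lift \<theta> is only assumed continuous. In the frame rotated by \<theta>(t) the
  point x(s) has coordinates \<open>k s\<close> and \<open>q s\<close>. For s near t the angle
  differs from \<theta>(t) by less than pi/2, so it equals \<theta>(t) + arctan (q/k), which can be
  differentiated.\<close>

lemma theta_deriv: "(\<theta> has_real_derivative c t / (r t)\<^sup>2) (at t)"
proof -
  define q where "q s = - sin (\<theta> t) * x s $ 1 + cos (\<theta> t) * x s $ 2" for s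
  define k where "k s = cos (\<theta> t) * x s $ 1 + sin (\<theta> t) * x s $ 2" for s
  have q: "q s = r s * sin (\<theta> s - \<theta> t)" and k: "k s = r s * cos (\<theta> s - \<theta> t)" for s
    by (simp_all add: q_def k_def x_nth sin_diff cos_diff algebra_simps)
  have "isCont \<theta> t" using theta_cont[of UNIV] by (simp add: continuous_on_eq_continuous_at)
  then have "\<forall>\<^sub>F s in nhds t. dist (\<theta> s) (\<theta> t) < pi / 2"
    by (intro tendstoD) (auto simp: isCont_def tendsto_at_iff_tendsto_nhds)
  then have ev: "\<forall>\<^sub>F s in nhds t. \<theta> s = \<theta> t + arctan (q s / k s)"
  proof eventually_elim
    case (elim s)
    have "q s / k s = tan (\<theta> s - \<theta> t)" using r_pos[of s] by (simp add: q k tan_def)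
    then show ?case using elim by (simp add: arctan_tan dist_real_def abs_if split: if_splits)
  qed
  have "((\<lambda>s. \<theta> t + arctan (q s / k s)) has_real_derivative c t / (r t)\<^sup>2) (at t)"
  proof -
    have kt: "k t = r t" and qt: "q t = 0" by (simp_all add: k q)
    have q': "(q has_real_derivative (- sin (\<theta> t) * v t $ 1 + cos (\<theta> t) * v t $ 2)) (at t)"
      unfolding q_def[abs_def] by (auto intro!: derivative_eq_intros x_nth_deriv)
    have k': "(k has_real_derivative (cos (\<theta> t) * v t $ 1 + sin (\<theta> t) * v t $ 2)) (at t)"
      unfolding k_def[abs_def] by (auto intro!: derivative_eq_intros x_nth_deriv)
    show ?thesis
      using r_pos[of t]
      by (auto intro!: derivative_eq_intros q' k' simp: kt qt c_def x_nth field_simps power2_eq_square)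
  qed
  then show ?thesis using DERIV_cong_ev[OF refl ev refl] by blast
qed

section \<open>Force components, angular momentum and energy\<close>

lemma potential_x: "potential \<alpha> V (x t) = W (\<theta> t) * r t powr - \<alpha>"
  by (simp add: x_polar potential_polar r_pos W_def)

text \<open>The chain rule for a curve that meets the orbit: the gradient is given only at the
  points \<open>x t\<close>, so nothing is asked of the curve away from the parameter
  \<open>s\<close>.\<close>

lemma potential_along:
  assumes "(y has_vector_derivative y') (at s)" "y s = x t"
  shows "((\<lambda>s. potential \<alpha> V (y s)) has_real_derivative a t \<bullet> y') (at s)"
proof -
  have "(potential \<alpha> V has_derivative (\<lambda>h. h \<bullet> a t)) (at (y s))"
    using gradient[of t] assms(2) by (simp add: gderiv_def)
  from has_derivative_compose[OF assms(1)[unfolded has_vector_derivative_def] this]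
  show ?thesis by (simp add: has_field_derivative_def inner_commute mult_commute_abs)
qed

text \<open>Euler's identity for a function homogeneous of degree -\<alpha>, obtained by
  differentiating along the ray s x(t) at s = 1.\<close>

lemma radial_force: "x t \<bullet> a t = - \<alpha> * W (\<theta> t) * r t powr - \<alpha>"
proof -
  have 1: "((\<lambda>s. potential \<alpha> V (s *\<^sub>R x t)) has_real_derivative a t \<bullet> x t) (at 1)"
    by (rule potential_along) (auto intro!: derivative_eq_intros)
  \<comment> \<open>The closed form is available only for s > 0, hence the comparison in a
    neighbourhood of 1.\<close>
  have ev: "\<forall>\<^sub>F s in nhds 1. potential \<alpha> V (s *\<^sub>R x t) = W (\<theta> t) * (s * r t) powr - \<alpha>"
    using eventually_nhds_in_open[of "{0<..}" "1::real"]
  proof (rule eventually_mono)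
    show "potential \<alpha> V (s *\<^sub>R x t) = W (\<theta> t) * (s * r t) powr - \<alpha>" if "s \<in> {0<..}" for s
      using potential_polar[of "s * r t" \<alpha> V "\<theta> t"] that r_pos[of t] by (simp add: x_polar W_def)
  qed auto
  have "((\<lambda>s. W (\<theta> t) * (s * r t) powr - \<alpha>) has_real_derivative - \<alpha> * W (\<theta> t) * r t powr - \<alpha>) (at 1)"
    using r_pos[of t] by (auto intro!: derivative_eq_intros simp: powr_diff)
  then show ?thesis
    using DERIV_unique[OF 1] DERIV_cong_ev[OF refl ev refl] by (simp add: inner_commute)
qed

text \<open>The torque is the derivative of the potential along the circle of radius
  \<open>r t\<close> through x(t).\<close>

lemma angular_force: "x t $ 1 * a t $ 2 - x t $ 2 * a t $ 1 = W1 (\<theta> t) * r t powr - \<alpha>"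
proof -
  have D: "((\<lambda>s. r t *\<^sub>R unit_vec s) has_vector_derivative
      (r t *\<^sub>R vector [- sin (\<theta> t), cos (\<theta> t)])) (at (\<theta> t))"
    unfolding has_vector_derivative_def
    by (rule has_derivative_componentwise_within[THEN iffD2])
       (auto simp: Basis_vec_def inner_axis forall_2 intro!: derivative_eq_intros)
  have 1: "((\<lambda>s. potential \<alpha> V (r t *\<^sub>R unit_vec s)) has_real_derivative
      a t \<bullet> (r t *\<^sub>R vector [- sin (\<theta> t), cos (\<theta> t)])) (at (\<theta> t))"
    by (rule potential_along[OF D]) (simp add: x_polar)
  have "((\<lambda>s. potential \<alpha> V (r t *\<^sub>R unit_vec s)) has_real_derivative W1 (\<theta> t) * r t powr - \<alpha>) (at (\<theta> t))"
    using r_pos[of t] DERIV_cmult_right[OF W_deriv] by (simp add: potential_polar flip: W_def)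
  from DERIV_unique[OF 1 this] show ?thesis
    by (simp add: inner_real2 x_nth algebra_simps)
qed

lemma c_deriv: "(c has_real_derivative W1 (\<theta> t) * r t powr - \<alpha>) (at t)"
  unfolding c_def[abs_def]
  by (auto intro!: derivative_eq_intros x_nth_deriv v_nth_deriv simp: algebra_simps simp flip: angular_force)

lemma energy_deriv: "((\<lambda>t. v t \<bullet> v t / 2 - potential \<alpha> V (x t)) has_real_derivative 0) (at t)"
proof -
  have "((\<lambda>t. v t \<bullet> v t / 2) has_real_derivative v t \<bullet> a t) (at t)"
    unfolding inner_real2 by (auto intro!: derivative_eq_intros v_nth_deriv simp: field_simps)
  from DERIV_diff[OF this potential_along[OF x_deriv refl]] show ?thesis by (simp add: inner_commute)
qed

lemma cont_along:
  "continuous_on S (\<lambda>t. x t $ i)" "continuous_on S (\<lambda>t. v t $ i)" "continuous_on S r" "continuous_on S c"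
  "continuous_on S p"
  "continuous_on S (\<lambda>t. W (\<theta> t))" "continuous_on S (\<lambda>t. W1 (\<theta> t))" "continuous_on S (\<lambda>t. W2 (\<theta> t))"
proof -
  show x: "continuous_on S (\<lambda>t. x t $ i)" for i
    by (rule DERIV_continuous_on) (rule has_field_derivative_at_within[OF x_nth_deriv])
  show v: "continuous_on S (\<lambda>t. v t $ i)" for i
    by (rule DERIV_continuous_on) (rule has_field_derivative_at_within[OF v_nth_deriv])
  show "continuous_on S r"
    by (meson DERIV_isCont r_deriv continuous_at_imp_continuous_on)
  show "continuous_on S c"
    by (meson DERIV_isCont c_deriv continuous_at_imp_continuous_on)
  show "continuous_on S p" unfolding p_def[abs_def] inner_real2 by (intro continuous_intros x v)
  show "continuous_on S (\<lambda>t. W (\<theta> t))" "continuous_on S (\<lambda>t. W1 (\<theta> t))" "continuous_on S (\<lambda>t. W2 (\<theta> t))"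
    by (auto intro: continuous_on_compose2[OF W_cont] continuous_on_compose2[OF W1_cont]
      continuous_on_compose2[OF W2_cont] theta_cont)
qed

end

section \<open>Parabolic solutions between minimizers\<close>

locale kepler_parabolic = kepler_motion +
  fixes \<theta>m \<theta>p :: real
  assumes r_top: "filterlim (\<lambda>t. norm (x t)) at_top at_top"
    and r_bot: "filterlim (\<lambda>t. norm (x t)) at_top at_bot"
    and v_top: "((\<lambda>t. norm (v t)) \<longlongrightarrow> 0) at_top"
    and theta_bot: "(\<theta> \<longlongrightarrow> \<theta>m) at_bot"
    and theta_top: "(\<theta> \<longlongrightarrow> \<theta>p) at_top"
    and min_bot: "\<And>\<phi>. angular V \<theta>m \<le> angular V \<phi>"
    and min_top: "\<And>\<phi>. angular V \<theta>p \<le> angular V \<phi>"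
    and V_pos: "\<And>z. z \<in> sphere 0 1 \<Longrightarrow> 0 < V z"
begin

section \<open>Zero energy, the Lagrange identity and the monotone quantity \<nu>\<close>

lemma W_pos: "0 < W \<phi>"
  by (auto simp: W_def angular_def intro!: V_pos)

text \<open>The energy is constant, and as t tends to infinity both of its terms vanish: the
  velocity by assumption, the potential because r grows while W(\<theta>) converges.\<close>

lemma zero_energy: "v t \<bullet> v t = 2 * W (\<theta> t) * r t powr - \<alpha>"
proof -
  let ?E = "\<lambda>t. v t \<bullet> v t / 2 - potential \<alpha> V (x t)"
  have const: "?E s = ?E t" for s
    using DERIV_isconst_all[of ?E] energy_deriv by blast
  have r: "filterlim r at_top at_top"
    using r_top by (simp add: r_eq_norm[abs_def])
  have "((\<lambda>t. W (\<theta> t)) \<longlongrightarrow> W \<theta>p) at_top"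
    using continuous_on_tendsto_compose[OF W_cont[of UNIV] theta_top] by simp
  moreover have "((\<lambda>t. r t powr - \<alpha>) \<longlongrightarrow> 0) at_top"
    using alpha r by (intro tendsto_neg_powr) auto
  ultimately have "((\<lambda>t. W (\<theta> t) * r t powr - \<alpha>) \<longlongrightarrow> W \<theta>p * 0) at_top"
    by (rule tendsto_mult)
  moreover have "((\<lambda>t. (norm (v t))\<^sup>2 / 2) \<longlongrightarrow> 0\<^sup>2 / 2) at_top"
    by (intro tendsto_intros v_top) simp
  ultimately have "(?E \<longlongrightarrow> 0\<^sup>2 / 2 - W \<theta>p * 0) at_top"
    by (simp only: potential_x flip: power2_norm_eq_inner) (rule tendsto_diff)
  moreover have "(?E \<longlongrightarrow> ?E t) at_top"
    by (intro tendsto_eventually always_eventually allI const)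
  ultimately have "?E t = 0\<^sup>2 / 2 - W \<theta>p * 0"
    using tendsto_unique trivial_limit_at_top_linorder by blast
  then show ?thesis by (simp add: potential_x)
qed

text \<open>The Lagrange-Jacobi identity at zero energy: v . v contributes 2 U and x . a contributes
  -\<alpha> U.\<close>

lemma p_deriv: "(p has_real_derivative (2 - \<alpha>) * W (\<theta> t) * r t powr - \<alpha>) (at t)"
proof -
  have "(p has_real_derivative v t \<bullet> v t + x t \<bullet> a t) (at t)"
    unfolding p_def[abs_def] inner_real2
    by (auto intro!: derivative_eq_intros x_nth_deriv v_nth_deriv)
  then show ?thesis by (simp add: zero_energy radial_force algebra_simps)
qed

text \<open>Lagrange's identity (x . v)^2 + (x ^ v)^2 = |x|^2 |v|^2, with |v|^2 replaced through
  zero energy.\<close>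

lemma lagrange: "(p t)\<^sup>2 + (c t)\<^sup>2 = 2 * (r t)\<^sup>2 * (W (\<theta> t) * r t powr - \<alpha>)"
proof -
  have "(p t)\<^sup>2 + (c t)\<^sup>2 = (r t)\<^sup>2 * (v t \<bullet> v t)"
    unfolding p_def c_def r_sq inner_real2 by algebra
  then show ?thesis by (simp add: zero_energy)
qed

text \<open>As p = r r', this is r' times r to the power \<alpha>/2.\<close>

definition \<nu> where "\<nu> t = p t * r t powr (\<alpha> / 2 - 1)"

text \<open>The product rule produces a positive multiple of 2 r^2 U - p^2, which is c^2 by
  \<open>lagrange\<close>.\<close>

lemma nu_deriv: "(\<nu> has_real_derivative (1 - \<alpha> / 2) * r t powr (\<alpha> / 2 - 3) * (c t)\<^sup>2) (at t)"
proof -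
  define q where "q = r t powr (\<alpha> / 2 - 3)"
  have q: "r t powr (\<alpha> / 2 - 1) = q * (r t)\<^sup>2" "r t powr (\<alpha> / 2 - 1 - 1) = q * r t"
    using r_pos[of t] by (simp_all add: q_def powr_diff power2_eq_square power3_eq_cube)
  have "(\<nu> has_real_derivative
      ((2 - \<alpha>) * W (\<theta> t) * r t powr - \<alpha>) * r t powr (\<alpha> / 2 - 1)
      + p t * ((\<alpha> / 2 - 1) * r t powr (\<alpha> / 2 - 1 - 1) * (p t / r t))) (at t)"
    unfolding \<nu>_def[abs_def] using r_pos[of t]
    by (auto intro!: derivative_eq_intros r_deriv p_deriv)
  moreover have "((2 - \<alpha>) * W (\<theta> t) * r t powr - \<alpha>) * r t powr (\<alpha> / 2 - 1)
      + p t * ((\<alpha> / 2 - 1) * r t powr (\<alpha> / 2 - 1 - 1) * (p t / r t))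
    = (1 - \<alpha> / 2) * q * (2 * (r t)\<^sup>2 * (W (\<theta> t) * r t powr - \<alpha>) - (p t)\<^sup>2)"
    unfolding q using r_pos[of t] by (simp add: field_simps power2_eq_square)
  moreover have "2 * (r t)\<^sup>2 * (W (\<theta> t) * r t powr - \<alpha>) - (p t)\<^sup>2 = (c t)\<^sup>2"
    using lagrange[of t] by simp
  ultimately show ?thesis by (simp add: q_def)
qed

lemma nu_sq: "(\<nu> t)\<^sup>2 = 2 * W (\<theta> t) - (c t)\<^sup>2 * r t powr (\<alpha> - 2)"
proof -
  have 1: "(r t powr (\<alpha> / 2 - 1))\<^sup>2 = r t powr (\<alpha> - 2)"
    by (simp add: power2_eq_square flip: powr_add)
  have 2: "r t powr (\<alpha> - 2) * ((r t)\<^sup>2 * r t powr - \<alpha>) = 1"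
    using r_pos[of t] by (simp add: powr_diff powr_minus field_simps)
  have "(\<nu> t)\<^sup>2 = ((p t)\<^sup>2 + (c t)\<^sup>2 - (c t)\<^sup>2) * r t powr (\<alpha> - 2)"
    by (simp add: \<nu>_def power_mult_distrib 1)
  also have "\<dots> = 2 * W (\<theta> t) * (r t powr (\<alpha> - 2) * ((r t)\<^sup>2 * r t powr - \<alpha>)) - (c t)\<^sup>2 * r t powr (\<alpha> - 2)"
    unfolding lagrange by (simp add: algebra_simps)
  finally show ?thesis by (simp add: 2)
qed

lemma nu_mono: "s \<le> t \<Longrightarrow> \<nu> s \<le> \<nu> t"
  by (rule DERIV_nonneg_imp_nondecreasing)
     (use alpha in \<open>auto intro!: exI conjI nu_deriv mult_nonneg_nonneg\<close>)

lemma abs_nu_le: "\<bar>\<nu> t\<bar> \<le> sqrt (2 * W (\<theta> t))"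
  using nu_sq[of t] real_le_rsqrt[of "\<bar>\<nu> t\<bar>" "2 * W (\<theta> t)"] by simp

lemma min_eq: "W \<theta>m = W \<theta>p"
  by (simp add: W_def antisym min_bot min_top)

text \<open>For s beyond t, \<nu>(t) is at most \<nu>(s), hence at most the square root of 2
  W(\<theta>(s)); let s tend to infinity. The lower bound \<open>nu_ge\<close> is the same argument
  towards minus infinity.\<close>

lemma nu_le: "\<nu> t \<le> sqrt (2 * W \<theta>p)"
proof (rule tendsto_lowerbound)
  have "((\<lambda>t. W (\<theta> t)) \<longlongrightarrow> W \<theta>p) at_top"
    using continuous_on_tendsto_compose[OF W_cont[of UNIV] theta_top] by simp
  then show "((\<lambda>s. sqrt (2 * W (\<theta> s))) \<longlongrightarrow> sqrt (2 * W \<theta>p)) at_top"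
    by (intro tendsto_intros)
  show "\<forall>\<^sub>F s in at_top. \<nu> t \<le> sqrt (2 * W (\<theta> s))"
    using eventually_ge_at_top[of t] by eventually_elim (use nu_mono abs_nu_le in \<open>smt (verit)\<close>)
qed simp

lemma nu_ge: "- sqrt (2 * W \<theta>p) \<le> \<nu> t"
proof (rule tendsto_upperbound)
  have "((\<lambda>t. W (\<theta> t)) \<longlongrightarrow> W \<theta>p) at_bot"
    using continuous_on_tendsto_compose[OF W_cont[of UNIV] theta_bot] by (simp add: min_eq)
  then show "((\<lambda>s. - sqrt (2 * W (\<theta> s))) \<longlongrightarrow> - sqrt (2 * W \<theta>p)) at_bot"
    by (intro tendsto_intros)
  show "\<forall>\<^sub>F s in at_bot. - sqrt (2 * W (\<theta> s)) \<le> \<nu> t"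
    using eventually_le_at_bot[of t] by eventually_elim (use nu_mono abs_nu_le in \<open>smt (verit)\<close>)
qed simp

section \<open>Absence of zeros of the angular momentum\<close>

text \<open>A Gronwall argument: the rays over critical points of \<open>W\<close> are invariant.\<close>

lemma radial_everywhere:
  assumes c0: "c t1 = 0" and crit: "W1 (\<theta> t1) = 0"
  shows "c t = 0"
proof -
  define f where "f t = (\<theta> t - \<theta> t1)\<^sup>2 + (c t)\<^sup>2" for t
  define f' where "f' t = 2 * (\<theta> t - \<theta> t1) * (c t / (r t)\<^sup>2) + 2 * c t * (W1 (\<theta> t) * r t powr - \<alpha>)" for t
  have "f t = 0"
  proof (rule gronwall_zero[where f = f and f' = f' and ?t1.0 = t1])
    show "(f has_real_derivative f' t) (at t)" for t
      unfolding f_def[abs_def] f'_def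
      by (auto intro!: derivative_eq_intros theta_deriv c_deriv)
    show "0 \<le> f t" for t by (simp add: f_def)
    show "f t1 = 0" by (simp add: f_def c0)
    fix A B
    \<comment> \<open>The interval is enlarged to contain \<open>t1\<close>, so that
      \<open>M\<close> bounds both angles compared by the mean value estimate.\<close>
    let ?I = "{min A t1..max B t1}"
    have "compact (\<theta> ` ?I)" by (intro compact_continuous_image theta_cont) simp
    then obtain M where M: "\<And>t. t \<in> ?I \<Longrightarrow> \<bar>\<theta> t\<bar> \<le> M"
      by (meson bounded_real compact_imp_bounded imageI)
    have "compact (W2 ` {-M..M})"
      using W2_cont by (intro compact_continuous_image continuous_on_subset[OF W2_cont]) auto
    then obtain L where L: "\<And>\<phi>. \<phi> \<in> {-M..M} \<Longrightarrow> \<bar>W2 \<phi>\<bar> \<le> L"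
      by (meson bounded_real compact_imp_bounded imageI)
    \<comment> \<open>After the Lipschitz bound on \<open>W1\<close>, both terms of f' are multiples
      of 2 |\<theta> - \<theta>(t1)| |c|. Their factors are 1/r^2 and L r^(-\<alpha>), and
      \<open>k\<close> bounds the sum.\<close>
    have "compact ((\<lambda>t. inverse ((r t)\<^sup>2) + L * r t powr - \<alpha>) ` ?I)"
      using r_pos by (intro compact_continuous_image continuous_intros cont_along) (auto simp: less_imp_neq[symmetric])
    then obtain k where k: "\<And>t. t \<in> ?I \<Longrightarrow> \<bar>inverse ((r t)\<^sup>2) + L * r t powr - \<alpha>\<bar> \<le> k"
      by (meson bounded_real compact_imp_bounded imageI)
    have "\<bar>f' t\<bar> \<le> k * f t" if t: "t \<in> {A..B}" for t
    proof -
      have tI: "t \<in> ?I" "t1 \<in> ?I" using t by auto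
      have lip: "\<bar>W1 (\<theta> t)\<bar> \<le> L * \<bar>\<theta> t - \<theta> t1\<bar>"
      proof -
        have "norm (W1 (\<theta> t) - W1 (\<theta> t1)) \<le> L * norm (\<theta> t - \<theta> t1)"
          by (rule field_differentiable_bound[of "{-M..M}" W1 W2])
             (use M[OF tI(1)] M[OF tI(2)] L in \<open>auto intro: has_field_derivative_at_within W1_deriv\<close>)
        then show ?thesis by (simp add: crit)
      qed
      let ?D = "\<bar>\<theta> t - \<theta> t1\<bar>" and ?C = "\<bar>c t\<bar>"
      have prod: "2 * ?D * ?C \<le> f t"
        using sum_squares_bound[of ?D ?C] by (simp add: f_def)
      have "\<bar>f' t\<bar> \<le> 2 * ?D * (?C / (r t)\<^sup>2) + 2 * ?C * (\<bar>W1 (\<theta> t)\<bar> * r t powr - \<alpha>)"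
        unfolding f'_def by (rule order_trans[OF abs_triangle_ineq]) (simp add: abs_mult del: right_diff_distrib_numeral)
      also have "\<dots> \<le> 2 * ?D * (?C / (r t)\<^sup>2) + 2 * ?C * (L * ?D * r t powr - \<alpha>)"
        using lip by (intro add_left_mono mult_left_mono mult_right_mono) auto
      also have "\<dots> = (inverse ((r t)\<^sup>2) + L * r t powr - \<alpha>) * (2 * ?D * ?C)"
        by (simp add: field_simps)
      also have "\<dots> \<le> k * (2 * ?D * ?C)"
        using k[OF tI(1)] by (intro mult_right_mono) auto
      also have "\<dots> \<le> k * f t"
        using k[OF tI(1)] prod by (intro mult_left_mono) auto
      finally show ?thesis .
    qed
    then show "\<exists>k. \<forall>t\<in>{A..B}. \<bar>f' t\<bar> \<le> k * f t" by blast
  qed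
  then show ?thesis by (simp add: f_def)
qed

text \<open>If c vanished identically, \<open>lagrange\<close> would keep p away from zero. But r is
  unbounded in both time directions, so r' and hence p take both signs. Since p is nondecreasing,
  the negative value comes first, and the intermediate value theorem gives a zero of p.\<close>

lemma not_homothetic: "\<exists>t. c t \<noteq> 0"
proof (rule ccontr)
  assume "\<nexists>t. c t \<noteq> 0"
  then have p: "p t \<noteq> 0" for t
    using lagrange[of t] W_pos[of "\<theta> t"] r_pos[of t] by auto
  have p_mono: "p s \<le> p t" if "s \<le> t" for s t
    by (rule DERIV_nonneg_imp_nondecreasing[OF that])
       (use alpha in \<open>auto intro!: exI conjI p_deriv mult_nonneg_nonneg less_imp_le[OF W_pos]\<close>)
  have far: "\<exists>s. 0 \<le> s \<and> r 0 < r s" "\<exists>s. s \<le> 0 \<and> r 0 < r s"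
  proof -
    have "\<forall>\<^sub>F s in at_top. r 0 < r s" "\<forall>\<^sub>F s in at_bot. r 0 < r s"
      using r_top r_bot by (simp_all add: filterlim_at_top_dense flip: r_eq_norm)
    from eventually_conj[OF this(1) eventually_ge_at_top[of 0]]
      eventually_conj[OF this(2) eventually_le_at_bot[of 0]]
    show "\<exists>s. 0 \<le> s \<and> r 0 < r s" "\<exists>s. s \<le> 0 \<and> r 0 < r s"
      by (auto dest: eventually_happens)
  qed
  have "\<exists>s. 0 < p s"
  proof (rule ccontr)
    assume neg: "\<not> (\<exists>s. 0 < p s)"
    obtain s where s: "0 \<le> s" "r 0 < r s" using far(1) by blast
    have "r s \<le> r 0"
      by (rule DERIV_nonpos_imp_nonincreasing[OF s(1)])
         (use neg in \<open>auto intro!: exI conjI r_deriv divide_nonpos_pos r_pos simp: not_less\<close>)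
    with s show False by simp
  qed
  moreover have "\<exists>s. p s < 0"
  proof (rule ccontr)
    assume neg: "\<not> (\<exists>s. p s < 0)"
    obtain s where s: "s \<le> 0" "r 0 < r s" using far(2) by blast
    have "r s \<le> r 0"
      by (rule DERIV_nonneg_imp_nondecreasing[OF s(1)])
         (use neg in \<open>auto intro!: exI conjI r_deriv divide_nonneg_pos r_pos simp: not_less\<close>)
    with s show False by simp
  qed
  ultimately obtain s1 s2 where s: "p s1 < 0" "0 < p s2" by blast
  then have "s1 \<le> s2" using p_mono[of s2 s1] by linarith
  then obtain s where "p s = 0"
    using IVT'[of p s1 0 s2] s cont_along(5) by fastforce
  with p show False by blast
qed

lemma c_nonzero: "c t \<noteq> 0"
proof
  assume c0: "c t = 0"
  have "2 * W \<theta>p \<le> (\<nu> t)\<^sup>2"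
    using nu_sq[of t] c0 min_top[of "\<theta> t"] by (simp add: W_def)
  then have "sqrt (2 * W \<theta>p) \<le> \<bar>\<nu> t\<bar>"
    using real_sqrt_le_mono by fastforce
  then consider "\<nu> t = sqrt (2 * W \<theta>p)" | "\<nu> t = - sqrt (2 * W \<theta>p)"
    using nu_le[of t] nu_ge[of t] by linarith
  \<comment> \<open>At a zero of c, \<nu> has reached one of its two bounds. By monotonicity it
    stays there on the whole half line after t (upper bound) or before t (lower bound).\<close>
  then obtain k J where J: "open J" "J \<noteq> {}" and const: "\<And>s. s \<in> J \<Longrightarrow> \<nu> s = k"
  proof cases
    case 1
    have "\<nu> s = sqrt (2 * W \<theta>p)" if "s \<in> {t<..}" for s
      using nu_mono[of t s] nu_le[of s] 1 that by simp
    then show ?thesis by (intro that[of "{t<..}"]) (auto simp: gt_ex)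
  next
    case 2
    have "\<nu> s = - sqrt (2 * W \<theta>p)" if "s \<in> {..<t}" for s
      using nu_mono[of s t] nu_ge[of s] 2 that by simp
    then show ?thesis by (intro that[of "{..<t}"]) (auto simp: lt_ex)
  qed
  have c: "c s = 0" if "s \<in> J" for s
  proof -
    have "(\<nu> has_real_derivative 0) (at s)"
      by (rule has_field_derivative_transform_within_open[OF DERIV_const[of k] J(1) that]) (simp add: const)
    then have "(1 - \<alpha> / 2) * r s powr (\<alpha> / 2 - 3) * (c s)\<^sup>2 = 0"
      using nu_deriv DERIV_unique by blast
    then show ?thesis using alpha r_pos[of s] by simp
  qed
  obtain s where s: "s \<in> J" using J by blast
  \<comment> \<open>On an open set where c vanishes so does c', which puts the angle at a critical
    point of \<open>W\<close>; the Gronwall lemma then spreads c = 0 to all times.\<close>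
  have "(c has_real_derivative 0) (at s)"
    by (rule has_field_derivative_transform_within_open[OF DERIV_const[of 0] J(1) s]) (simp add: c)
  then have "W1 (\<theta> s) * r s powr - \<alpha> = 0"
    using c_deriv DERIV_unique by blast
  then have "W1 (\<theta> s) = 0" using r_pos[of s] by simp
  with radial_everywhere[OF c[OF s]] not_homothetic show False by blast
qed

lemma oscillation_index_zero: "oscillation_index \<theta> = 0"
proof -
  have "\<not> (\<theta> has_real_derivative 0) (at t)" for t
    using DERIV_unique[OF theta_deriv] c_nonzero[of t] r_pos[of t] by force
  then show ?thesis by (simp add: oscillation_index_def zero_enat_def)
qed

end

section \<open>The Riccati equation along the solution\<close>

context kepler_parabolic
begin

text \<open>\<open>P\<close> is r'/r, the angular velocity is \<open>\<omega>\<close>, and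
  \<open>N\<close> is r^(-\<alpha>-2), the scale of the Hessian of the potential at distance
  r.\<close>

definition P where "P t = p t / (r t)\<^sup>2"
definition \<omega> where "\<omega> t = c t / (r t)\<^sup>2"
definition N where "N t = r t powr - \<alpha> / (r t)\<^sup>2"
text \<open>This is the logarithmic derivative c'/c of the angular momentum. It exists for all times
  because c has no zeros, and it is where that fact enters the Morse index.\<close>

definition \<beta> where "\<beta> t = N t * W1 (\<theta> t) / \<omega> t"

lemma omega_nonzero: "\<omega> t \<noteq> 0"
  using c_nonzero[of t] r_pos[of t] by (simp add: \<omega>_def)

lemma theta_deriv': "(\<theta> has_real_derivative \<omega> t) (at t)"
  using theta_deriv by (simp add: \<omega>_def)

lemma P_deriv: "(P has_real_derivative (2 - \<alpha>) * W (\<theta> t) * N t - 2 * (P t)\<^sup>2) (at t)"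
  unfolding P_def[abs_def] N_def using r_pos[of t]
  by (auto intro!: derivative_eq_intros p_deriv r_deriv simp: field_simps power2_eq_square)

lemma omega_deriv: "(\<omega> has_real_derivative N t * W1 (\<theta> t) - 2 * P t * \<omega> t) (at t)"
  unfolding \<omega>_def[abs_def] N_def P_def using r_pos[of t]
  by (auto intro!: derivative_eq_intros c_deriv r_deriv simp: field_simps power2_eq_square)

lemma N_deriv: "(N has_real_derivative - (\<alpha> + 2) * N t * P t) (at t)"
proof -
  have "r t powr (- \<alpha> - 1) = r t powr - \<alpha> / r t" using r_pos[of t] by (simp add: powr_diff)
  then show ?thesis
    unfolding N_def[abs_def] P_def using r_pos[of t]
    by (auto intro!: derivative_eq_intros r_deriv simp: field_simps power2_eq_square)
qed

lemma W1_theta_deriv: "((\<lambda>t. W1 (\<theta> t)) has_real_derivative W2 (\<theta> t) * \<omega> t) (at t)"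
  using DERIV_chain2[OF W1_deriv theta_deriv'] .

lemma beta_deriv: "(\<beta> has_real_derivative N t * W2 (\<theta> t) - \<alpha> * P t * \<beta> t - (\<beta> t)\<^sup>2) (at t)"
  unfolding \<beta>_def[abs_def] using omega_nonzero[of t]
  by (auto intro!: derivative_eq_intros N_deriv W1_theta_deriv omega_deriv
      simp: field_simps power2_eq_square)

text \<open>\<open>lagrange\<close> divided by r^4. Together with \<open>beta_omega\<close> it is
  the relation modulo which the Riccati equation becomes a polynomial identity.\<close>

lemma P_omega: "(P t)\<^sup>2 + (\<omega> t)\<^sup>2 = 2 * N t * W (\<theta> t)"
proof -
  have "(P t)\<^sup>2 + (\<omega> t)\<^sup>2 = ((p t)\<^sup>2 + (c t)\<^sup>2) / ((r t)\<^sup>2)\<^sup>2"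
    by (simp add: P_def \<omega>_def power_divide add_divide_distrib)
  then show ?thesis
    unfolding lagrange N_def using r_pos[of t] by (simp add: field_simps power2_eq_square)
qed

lemma beta_omega: "\<beta> t * \<omega> t = N t * W1 (\<theta> t)"
  using omega_nonzero by (simp add: \<beta>_def)

lemma coefficient_cont:
  "continuous_on S P" "continuous_on S \<omega>" "continuous_on S N" "continuous_on S \<beta>"
proof -
  show P: "continuous_on S P"
    by (rule DERIV_continuous_on) (rule has_field_derivative_at_within[OF P_deriv])
  show \<omega>: "continuous_on S \<omega>"
    by (rule DERIV_continuous_on) (rule has_field_derivative_at_within[OF omega_deriv])
  show N: "continuous_on S N"
    by (rule DERIV_continuous_on) (rule has_field_derivative_at_within[OF N_deriv])
  show \<beta>: "continuous_on S \<beta>"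
    by (rule DERIV_continuous_on) (rule has_field_derivative_at_within[OF beta_deriv])
qed

section \<open>The Hessian and the Riccati matrix in the polar frame\<close>

text \<open>The Hessian of the potential at \<open>x t\<close> in the polar frame.\<close>

definition hess :: "real \<Rightarrow> real \<Rightarrow> real \<Rightarrow> real" where
  "hess t \<rho> \<sigma> = N t * (\<alpha> * (\<alpha> + 1) * W (\<theta> t) * \<rho>\<^sup>2 - 2 * (\<alpha> + 1) * W1 (\<theta> t) * \<rho> * \<sigma>
      + (W2 (\<theta> t) - \<alpha> * W (\<theta> t)) * \<sigma>\<^sup>2)"

text \<open>
  The entries of \<open>A\<close> in the polar frame are read off from \<open>A x' = x''\<close> and \<open>A x = -(\<alpha>/2) x'\<close>, which
  say that \<open>A\<close> maps the two Jacobi fields to their derivatives.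
\<close>

definition a11 where "a11 t = - (\<alpha> / 2) * P t"
definition a12 where "a12 t = - (\<alpha> / 2) * \<omega> t"
definition a22 where "a22 t = (\<alpha> / 2) * P t + \<beta> t"

definition a11' where "a11' t = - (\<alpha> / 2) * ((2 - \<alpha>) * W (\<theta> t) * N t - 2 * (P t)\<^sup>2)"
definition a12' where "a12' t = - (\<alpha> / 2) * (N t * W1 (\<theta> t) - 2 * P t * \<omega> t)"
definition a22' where "a22' t = (\<alpha> / 2) * ((2 - \<alpha>) * W (\<theta> t) * N t - 2 * (P t)\<^sup>2)
    + (N t * W2 (\<theta> t) - \<alpha> * P t * \<beta> t - (\<beta> t)\<^sup>2)"

text \<open>The three entries of A' + A^2 = D^2 U in the moving frame; the terms with an explicit
  \<open>\<omega> t\<close> come from the rotation of the frame.\<close>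

lemma riccati:
  "a11' t - 2 * a12 t * \<omega> t + (a11 t)\<^sup>2 + (a12 t)\<^sup>2 = \<alpha> * (\<alpha> + 1) * (N t * W (\<theta> t))"
  "a12' t + \<omega> t * (a11 t - a22 t) + a12 t * (a11 t + a22 t) = - (\<alpha> + 1) * (N t * W1 (\<theta> t))"
  "a22' t + 2 * a12 t * \<omega> t + (a12 t)\<^sup>2 + (a22 t)\<^sup>2 = N t * W2 (\<theta> t) - \<alpha> * (N t * W (\<theta> t))"
proof -
  \<comment> \<open>Writing \<alpha> = 2 k clears the halves, leaving polynomial identities modulo
    the two relations in \<open>rel\<close>.\<close>
  define k where "k = \<alpha> / 2"
  have \<alpha>: "\<alpha> = 2 * k" by (simp add: k_def)
  have a: "a11 t = - k * P t" "a12 t = - k * \<omega> t" "a22 t = k * P t + \<beta> t"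
    "a11' t = - k * ((2 - 2 * k) * W (\<theta> t) * N t - 2 * (P t)\<^sup>2)"
    "a12' t = - k * (N t * W1 (\<theta> t) - 2 * P t * \<omega> t)"
    "a22' t = k * ((2 - 2 * k) * W (\<theta> t) * N t - 2 * (P t)\<^sup>2)
      + (N t * W2 (\<theta> t) - 2 * k * P t * \<beta> t - (\<beta> t)\<^sup>2)"
    by (simp_all add: a11_def a12_def a22_def a11'_def a12'_def a22'_def k_def)
  note rel = P_omega[of t] beta_omega[of t]
  show "a11' t - 2 * a12 t * \<omega> t + (a11 t)\<^sup>2 + (a12 t)\<^sup>2 = \<alpha> * (\<alpha> + 1) * (N t * W (\<theta> t))"
    using rel \<alpha> unfolding a by algebra
  show "a12' t + \<omega> t * (a11 t - a22 t) + a12 t * (a11 t + a22 t) = - (\<alpha> + 1) * (N t * W1 (\<theta> t))"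
    using rel \<alpha> unfolding a by algebra
  show "a22' t + 2 * a12 t * \<omega> t + (a12 t)\<^sup>2 + (a22 t)\<^sup>2 = N t * W2 (\<theta> t) - \<alpha> * (N t * W (\<theta> t))"
    using rel \<alpha> unfolding a by algebra
qed

text \<open>Let (\<rho>, \<sigma>) and (k, l) be the frame components of h and h'. Then \<rho>' = k
  + \<omega> \<sigma> and \<sigma>' = l - \<omega> \<rho>, so the left side is the derivative of h .
  A h. The right side is |h'|^2 + D^2 U[h,h] - |h' - A h|^2.\<close>

lemma riccati_completion:
  "a11' t * \<rho>\<^sup>2 + 2 * a12' t * \<rho> * \<sigma> + a22' t * \<sigma>\<^sup>2
     + 2 * (a11 t * \<rho> + a12 t * \<sigma>) * (k + \<omega> t * \<sigma>) + 2 * (a12 t * \<rho> + a22 t * \<sigma>) * (l - \<omega> t * \<rho>)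
   = k\<^sup>2 + l\<^sup>2 + hess t \<rho> \<sigma> - (k - (a11 t * \<rho> + a12 t * \<sigma>))\<^sup>2 - (l - (a12 t * \<rho> + a22 t * \<sigma>))\<^sup>2"
proof -
  have "hess t \<rho> \<sigma> = \<alpha> * (\<alpha> + 1) * (N t * W (\<theta> t)) * \<rho>\<^sup>2 + 2 * (- (\<alpha> + 1) * (N t * W1 (\<theta> t))) * \<rho> * \<sigma>
      + (N t * W2 (\<theta> t) - \<alpha> * (N t * W (\<theta> t))) * \<sigma>\<^sup>2"
    unfolding hess_def by (simp add: algebra_simps)
  then show ?thesis
    unfolding riccati[symmetric] by (simp add: algebra_simps power2_eq_square)
qed

lemma a_has_ac_deriv:
  "has_ac_deriv a11 a11' b d" "has_ac_deriv a12 a12' b d" "has_ac_deriv a22 a22' b d"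
  unfolding a11_def[abs_def] a11'_def[abs_def] a12_def[abs_def] a12'_def[abs_def] a22_def[abs_def] a22'_def[abs_def]
  by (intro has_ac_deriv_C1 DERIV_cmult DERIV_add P_deriv omega_deriv beta_deriv
      continuous_intros coefficient_cont cont_along)+

section \<open>Variations in the rotating frame and the completed square\<close>

definition radial :: "(real \<Rightarrow> real^2) \<Rightarrow> real \<Rightarrow> real" where
  "radial h t = cos (\<theta> t) * h t $ 1 + sin (\<theta> t) * h t $ 2"

definition tangential :: "(real \<Rightarrow> real^2) \<Rightarrow> real \<Rightarrow> real" where
  "tangential h t = - sin (\<theta> t) * h t $ 1 + cos (\<theta> t) * h t $ 2"

text \<open>The frame is that of the orbit at time t, not of h. Its vectors satisfy e_r' = \<omega>
  e_\<theta> and e_\<theta>' = -\<omega> e_r, whence the extra terms in the product rule.\<close>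

lemma frame_has_ac_deriv:
  assumes h: "has_weak_deriv h g b d"
  shows "has_ac_deriv (radial h) (\<lambda>t. radial g t + \<omega> t * tangential h t) b d"
    and "has_ac_deriv (tangential h) (\<lambda>t. tangential g t - \<omega> t * radial h t) b d"
proof -
  have cos: "has_ac_deriv (\<lambda>t. cos (\<theta> t)) (\<lambda>t. - sin (\<theta> t) * \<omega> t) b d"
    and sin: "has_ac_deriv (\<lambda>t. sin (\<theta> t)) (\<lambda>t. cos (\<theta> t) * \<omega> t) b d"
    and nsin: "has_ac_deriv (\<lambda>t. - sin (\<theta> t)) (\<lambda>t. - cos (\<theta> t) * \<omega> t) b d"
    by (auto intro!: has_ac_deriv_C1 derivative_eq_intros theta_deriv' continuous_intros
        coefficient_cont theta_cont)
  note H = has_weak_deriv_nth[OF h]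
  show "has_ac_deriv (radial h) (\<lambda>t. radial g t + \<omega> t * tangential h t) b d"
    unfolding radial_def[abs_def]
    by (rule has_ac_deriv_cong[OF has_ac_deriv_add[OF has_ac_deriv_mult[OF cos H]
        has_ac_deriv_mult[OF sin H]]]) (simp add: tangential_def algebra_simps)
  show "has_ac_deriv (tangential h) (\<lambda>t. tangential g t - \<omega> t * radial h t) b d"
    unfolding tangential_def[abs_def]
    by (rule has_ac_deriv_cong[OF has_ac_deriv_add[OF has_ac_deriv_mult[OF nsin H]
        has_ac_deriv_mult[OF cos H]]]) (simp add: radial_def algebra_simps)
qed

lemma frame_norm: "(radial g t)\<^sup>2 + (tangential g t)\<^sup>2 = (norm (g t))\<^sup>2"
proof -
  have "(radial g t)\<^sup>2 + (tangential g t)\<^sup>2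
      = ((cos (\<theta> t))\<^sup>2 + (sin (\<theta> t))\<^sup>2) * ((g t $ 1)\<^sup>2 + (g t $ 2)\<^sup>2)"
    unfolding radial_def tangential_def by algebra
  then show ?thesis
    by (simp add: power2_norm_eq_inner inner_real2 flip: power2_eq_square)
qed

text \<open>The function \<open>s\<close> is the derivative of h . A h, so its integral is zero
  because h vanishes at both ends. By \<open>riccati_completion\<close> it lies below the integrand
  of the second variation, the gap being a sum of two squares.\<close>

lemma second_variation_nonneg:
  assumes h: "has_weak_deriv h g b d" and "h b = 0" "h d = 0" "b \<le> d"
  shows "0 \<le> (LINT t:{b..d}|lborel. (norm (g t))\<^sup>2)
    + (LINT t:{b..d}|lborel. hess t (radial h t) (tangential h t))"
proof -
  note fr = frame_has_ac_deriv[OF h]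
  note cont = has_ac_deriv_continuous[OF fr(1)] has_ac_deriv_continuous[OF fr(2)]
  define s where "s t = a11' t * (radial h t)\<^sup>2 + 2 * a12' t * radial h t * tangential h t + a22' t * (tangential h t)\<^sup>2
     + 2 * (a11 t * radial h t + a12 t * tangential h t) * (radial g t + \<omega> t * tangential h t)
     + 2 * (a12 t * radial h t + a22 t * tangential h t) * (tangential g t - \<omega> t * radial h t)" for t
  have const2: "has_ac_deriv (\<lambda>t. 2) (\<lambda>t. 0) b d"
    by (intro has_ac_deriv_C1) (auto intro!: derivative_eq_intros)
  have S: "has_ac_deriv (\<lambda>t. a11 t * (radial h t * radial h t) +
      (2 * (a12 t * (radial h t * tangential h t)) + a22 t * (tangential h t * tangential h t))) s b d"
    by (rule has_ac_deriv_cong[OF has_ac_deriv_add[OF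
            has_ac_deriv_mult[OF a_has_ac_deriv(1) has_ac_deriv_mult[OF fr(1) fr(1)]]
            has_ac_deriv_add[OF
              has_ac_deriv_mult[OF const2
                has_ac_deriv_mult[OF a_has_ac_deriv(2) has_ac_deriv_mult[OF fr]]]
              has_ac_deriv_mult[OF a_has_ac_deriv(3) has_ac_deriv_mult[OF fr(2) fr(2)]]]]])
       (simp add: s_def algebra_simps power2_eq_square)
  have frame0: "radial h b = 0" "tangential h b = 0" "radial h d = 0" "tangential h d = 0"
    by (simp_all add: radial_def tangential_def assms)
  have s0: "(LINT t:{b..d}|lborel. s t) = 0" and s: "set_integrable lborel {b..d} s"
    using S \<open>b \<le> d\<close> by (simp_all add: has_ac_deriv_def frame0)
  have g2: "set_integrable lborel {b..d} (\<lambda>t. (norm (g t))\<^sup>2)"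
    using h by (simp add: has_weak_deriv_def)
  have hs: "set_integrable lborel {b..d} (\<lambda>t. hess t (radial h t) (tangential h t))"
  proof -
    have "continuous_on {b..d} (\<lambda>t. hess t (radial h t) (tangential h t))"
      unfolding hess_def by (intro continuous_intros cont coefficient_cont cont_along)
    then show ?thesis by (rule borel_integrable_atLeastAtMost')
  qed
  have "0 = (LINT t:{b..d}|lborel. s t)" using s0 by simp
  also have "\<dots> \<le> (LINT t:{b..d}|lborel. (norm (g t))\<^sup>2 + hess t (radial h t) (tangential h t))"
  proof (intro set_integral_mono s set_integral_add g2 hs)
    fix t
    show "s t \<le> (norm (g t))\<^sup>2 + hess t (radial h t) (tangential h t)"
      unfolding s_def riccati_completion by (simp add: frame_norm diff_le_eq add_increasing2)
  qed
  also have "\<dots> = (LINT t:{b..d}|lborel. (norm (g t))\<^sup>2)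
    + (LINT t:{b..d}|lborel. hess t (radial h t) (tangential h t))"
    by (intro set_integral_add g2 hs)
  finally show ?thesis .
qed

end

section \<open>The second variation of the action\<close>

context kepler_parabolic
begin

section \<open>The potential along a displaced point of the orbit\<close>

text \<open>
  The potential and its first two derivatives along \<open>w \<mapsto> x t + w (\<rho> e\<^sub>r + \<sigma> e\<^sub>\<theta>)\<close>, written through
  the lift \<open>\<theta> + arctan (w \<sigma> / (r + w \<rho>))\<close> of the angle, as long as \<open>r + w \<rho> > 0\<close>.
\<close>

definition nsq where "nsq t \<rho> \<sigma> w = (r t + w * \<rho>)\<^sup>2 + (w * \<sigma>)\<^sup>2"
definition ang where "ang t \<rho> \<sigma> w = \<theta> t + arctan (w * \<sigma> / (r t + w * \<rho>))"
text \<open>The inner product of the displaced point with the displacement, hence half the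
  derivative of \<open>nsq\<close>.\<close>

definition hz where "hz t \<rho> \<sigma> w = \<rho> * (r t + w * \<rho>) + w * \<sigma>\<^sup>2"

definition G0 where "G0 t \<rho> \<sigma> w = W (ang t \<rho> \<sigma> w) * nsq t \<rho> \<sigma> w powr (- (\<alpha> / 2))"

text \<open>The factor \<open>r t * \<sigma>\<close> is the determinant of the displaced point and
  the displacement, which does not depend on \<open>w\<close>; divided by \<open>nsq\<close> it is
  the derivative of the angle.\<close>

definition G1 where "G1 t \<rho> \<sigma> w = nsq t \<rho> \<sigma> w powr (- (\<alpha> / 2) - 1) *
  (W1 (ang t \<rho> \<sigma> w) * (r t * \<sigma>) - \<alpha> * W (ang t \<rho> \<sigma> w) * hz t \<rho> \<sigma> w)"

definition G2 where "G2 t \<rho> \<sigma> w = nsq t \<rho> \<sigma> w powr (- (\<alpha> / 2) - 2) *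
  (W2 (ang t \<rho> \<sigma> w) * (r t * \<sigma>)\<^sup>2 - 2 * (\<alpha> + 1) * W1 (ang t \<rho> \<sigma> w) * (r t * \<sigma>) * hz t \<rho> \<sigma> w
   + \<alpha> * (\<alpha> + 2) * W (ang t \<rho> \<sigma> w) * (hz t \<rho> \<sigma> w)\<^sup>2 - \<alpha> * W (ang t \<rho> \<sigma> w) * nsq t \<rho> \<sigma> w * (\<rho>\<^sup>2 + \<sigma>\<^sup>2))"

text \<open>In the frame at x(t) the displaced point has coordinates X > 0 and Y. It lies in the
  right half plane, where arctan (Y/X) is its polar angle.\<close>

lemma potential_G0:
  assumes pos: "0 < r t + w * radial h t"
  shows "potential \<alpha> V (x t + w *\<^sub>R h t) = G0 t (radial h t) (tangential h t) w"
proof -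
  define X where "X = r t + w * radial h t"
  define Y where "Y = w * tangential h t"
  define n where "n = X\<^sup>2 + Y\<^sup>2"
  have X: "0 < X" using pos by (simp add: X_def)
  then have n: "0 < n" by (simp add: n_def add_pos_nonneg)
  have h: "h t $ 1 = radial h t * cos (\<theta> t) - tangential h t * sin (\<theta> t)"
    "h t $ 2 = radial h t * sin (\<theta> t) + tangential h t * cos (\<theta> t)"
    using sin_cos_squared_add[of "\<theta> t"] unfolding radial_def tangential_def by algebra+
  have sq: "sqrt (1 + (Y / X)\<^sup>2) = sqrt n / X"
  proof -
    have "1 + (Y / X)\<^sup>2 = n / X\<^sup>2" using X by (simp add: n_def field_simps)
    then show ?thesis using X by (simp add: real_sqrt_divide)
  qed
  define \<psi> where "\<psi> = arctan (Y / X)"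
  have cs: "sqrt n * cos \<psi> = X" "sqrt n * sin \<psi> = Y"
    using X n by (simp_all add: \<psi>_def cos_arctan sin_arctan sq)
  have "sqrt n * cos (\<theta> t + \<psi>) = cos (\<theta> t) * X - sin (\<theta> t) * Y"
    "sqrt n * sin (\<theta> t + \<psi>) = sin (\<theta> t) * X + cos (\<theta> t) * Y"
    unfolding cos_add sin_add cs[symmetric] by (simp_all add: algebra_simps)
  then have "x t + w *\<^sub>R h t = sqrt n *\<^sub>R unit_vec (\<theta> t + \<psi>)"
    by (simp add: vec_eq_iff forall_2 x_nth h) (simp add: X_def Y_def algebra_simps)
  moreover have "sqrt n powr - \<alpha> = n powr (- (\<alpha> / 2))"
    using n by (simp add: powr_half_sqrt[symmetric] powr_powr)
  ultimately show ?thesis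
    using n by (simp add: potential_polar W_def[symmetric] G0_def ang_def nsq_def X_def Y_def n_def \<psi>_def)
qed

context
  fixes t \<rho> \<sigma> w :: real
  assumes pos: "0 < r t + w * \<rho>"
begin

lemma nsq_pos: "0 < nsq t \<rho> \<sigma> w"
  using pos by (simp add: nsq_def add_pos_nonneg)

lemma nsq_deriv: "(nsq t \<rho> \<sigma> has_real_derivative 2 * hz t \<rho> \<sigma> w) (at w)"
  unfolding nsq_def[abs_def] hz_def
  by (auto intro!: derivative_eq_intros simp: algebra_simps power2_eq_square)

lemma nsq_powr_deriv:
  "((\<lambda>w. nsq t \<rho> \<sigma> w powr k) has_real_derivative k * nsq t \<rho> \<sigma> w powr (k - 1) * (2 * hz t \<rho> \<sigma> w)) (at w)"
  using nsq_pos by (auto intro!: derivative_eq_intros nsq_deriv)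

lemma ang_deriv: "(ang t \<rho> \<sigma> has_real_derivative r t * \<sigma> / nsq t \<rho> \<sigma> w) (at w)"
proof -
  have "((\<lambda>w. w * \<sigma> / (r t + w * \<rho>)) has_real_derivative r t * \<sigma> / (r t + w * \<rho>)\<^sup>2) (at w)"
    using pos by (auto intro!: derivative_eq_intros simp: power2_eq_square algebra_simps)
  from DERIV_add[OF DERIV_const[of "\<theta> t"] DERIV_chain2[OF DERIV_arctan this]]
  have "(ang t \<rho> \<sigma> has_real_derivative
      inverse (1 + (w * \<sigma> / (r t + w * \<rho>))\<^sup>2) * (r t * \<sigma> / (r t + w * \<rho>)\<^sup>2)) (at w)"
    by (simp add: ang_def[abs_def])
  moreover have "inverse (1 + (w * \<sigma> / (r t + w * \<rho>))\<^sup>2) = (r t + w * \<rho>)\<^sup>2 / nsq t \<rho> \<sigma> w"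
  proof -
    have "1 + (w * \<sigma> / (r t + w * \<rho>))\<^sup>2 = nsq t \<rho> \<sigma> w / (r t + w * \<rho>)\<^sup>2"
      using pos by (simp add: nsq_def power_divide add_divide_distrib)
    then show ?thesis by simp
  qed
  ultimately show ?thesis using pos by simp
qed

lemma hz_deriv: "(hz t \<rho> \<sigma> has_real_derivative \<rho>\<^sup>2 + \<sigma>\<^sup>2) (at w)"
  unfolding hz_def[abs_def]
  by (auto intro!: derivative_eq_intros simp: algebra_simps power2_eq_square)

lemma G0_deriv: "(G0 t \<rho> \<sigma> has_real_derivative G1 t \<rho> \<sigma> w) (at w)"
proof -
  have "nsq t \<rho> \<sigma> w powr (- (\<alpha> / 2)) = nsq t \<rho> \<sigma> w powr (- (\<alpha> / 2) - 1) * nsq t \<rho> \<sigma> w"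
    using nsq_pos by (simp add: powr_diff)
  moreover have "(G0 t \<rho> \<sigma> has_real_derivative
      W1 (ang t \<rho> \<sigma> w) * (r t * \<sigma> / nsq t \<rho> \<sigma> w) * nsq t \<rho> \<sigma> w powr (- (\<alpha> / 2))
      + W (ang t \<rho> \<sigma> w) * (- (\<alpha> / 2) * nsq t \<rho> \<sigma> w powr (- (\<alpha> / 2) - 1) * (2 * hz t \<rho> \<sigma> w))) (at w)"
    unfolding G0_def[abs_def]
    by (rule DERIV_cong[OF DERIV_mult[OF DERIV_chain2[OF W_deriv ang_deriv] nsq_powr_deriv]]) simp
  ultimately show ?thesis
    unfolding G1_def using nsq_pos by (simp add: algebra_simps)
qed

lemma G1_deriv: "(G1 t \<rho> \<sigma> has_real_derivative G2 t \<rho> \<sigma> w) (at w)"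
proof -
  define q where "q = nsq t \<rho> \<sigma> w powr (- (\<alpha> / 2) - 2)"
  have q: "nsq t \<rho> \<sigma> w powr (- (\<alpha> / 2) - 1) = q * nsq t \<rho> \<sigma> w"
    using nsq_pos by (simp add: q_def powr_diff power2_eq_square)
  have q': "nsq t \<rho> \<sigma> w powr (- (\<alpha> / 2) - 1 - 1) = q" by (simp add: q_def algebra_simps)
  have "(G1 t \<rho> \<sigma> has_real_derivative
      (- (\<alpha> / 2) - 1) * nsq t \<rho> \<sigma> w powr (- (\<alpha> / 2) - 1 - 1) * (2 * hz t \<rho> \<sigma> w) *
        (W1 (ang t \<rho> \<sigma> w) * (r t * \<sigma>) - \<alpha> * W (ang t \<rho> \<sigma> w) * hz t \<rho> \<sigma> w)
      + nsq t \<rho> \<sigma> w powr (- (\<alpha> / 2) - 1) *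
        (W2 (ang t \<rho> \<sigma> w) * (r t * \<sigma> / nsq t \<rho> \<sigma> w) * (r t * \<sigma>)
         - \<alpha> * (W1 (ang t \<rho> \<sigma> w) * (r t * \<sigma> / nsq t \<rho> \<sigma> w) * hz t \<rho> \<sigma> w
                + W (ang t \<rho> \<sigma> w) * (\<rho>\<^sup>2 + \<sigma>\<^sup>2)))) (at w)"
    (is "(_ has_real_derivative ?D) _")
    unfolding G1_def[abs_def]
    by (rule DERIV_cong[OF DERIV_mult[OF nsq_powr_deriv DERIV_diff[OF
            DERIV_cmult_right[OF DERIV_chain2[OF W1_deriv ang_deriv]]
            DERIV_mult[OF DERIV_cmult[OF DERIV_chain2[OF W_deriv ang_deriv]] hz_deriv]]]])
       (simp add: algebra_simps)
  moreover have "?D = G2 t \<rho> \<sigma> w"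
    unfolding G2_def q q' q_def[symmetric] using nsq_pos by (simp add: field_simps power2_eq_square)
  ultimately show ?thesis by simp
qed

end

text \<open>This identifies \<open>hess\<close> as the second directional derivative of the
  potential at \<open>x t\<close>.\<close>

lemma G2_zero: "G2 t \<rho> \<sigma> 0 = hess t \<rho> \<sigma>"
proof -
  have "((r t)\<^sup>2) powr (- (\<alpha> / 2) - 2) = (r t powr 2) powr (- (\<alpha> / 2) - 2)"
    using r_pos[of t] by simp
  also have "\<dots> = r t powr (- \<alpha> - 4)"
    unfolding powr_powr by (rule arg_cong[of _ _ "(powr) (r t)"]) simp
  also have "\<dots> = r t powr - \<alpha> / r t ^ 4"
    using r_pos[of t] by (simp add: powr_diff)
  finally have key: "((r t)\<^sup>2) powr (- (\<alpha> / 2) - 2) = r t powr - \<alpha> / r t ^ 4" .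
  have at0: "nsq t \<rho> \<sigma> 0 = (r t)\<^sup>2" "ang t \<rho> \<sigma> 0 = \<theta> t" "hz t \<rho> \<sigma> 0 = \<rho> * r t"
    by (simp_all add: nsq_def ang_def hz_def)
  show ?thesis
    unfolding hess_def G2_def N_def at0 key
    using r_pos[of t] by (simp add: field_simps power2_eq_square power4_eq_xxxx)
qed

text \<open>With both directions equal to h, the iterated derivative is the second derivative at w =
  0 of the action of x + w h. Differentiating twice under the integral gives the quadratic form of
  \<open>second_variation_nonneg\<close>.\<close>

lemma action_deriv2_nonneg:
  assumes h: "h \<in> W0 b d" and "b < d"
  shows "0 \<le> action_deriv2 (potential \<alpha> V) b d x h h"
proof -
  obtain g where g: "has_weak_deriv h g b d" and h0: "h b = 0" "h d = 0"
    using h by (auto simp: W0_def)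
  let ?\<rho> = "radial h" and ?\<sigma> = "tangential h"
  note fr = frame_has_ac_deriv[OF g]
  have cont: "continuous_on {b..d} ?\<rho>" "continuous_on {b..d} ?\<sigma>"
    using fr by (auto intro: has_ac_deriv_continuous)
  have "compact (?\<rho> ` {b..d})" by (intro compact_continuous_image cont) simp
  then obtain M where M: "\<And>t. t \<in> {b..d} \<Longrightarrow> \<bar>?\<rho> t\<bar> \<le> M"
    by (meson bounded_real compact_imp_bounded imageI)
  obtain t0 where t0: "\<And>t. t \<in> {b..d} \<Longrightarrow> r t0 \<le> r t"
    using continuous_attains_inf[of "{b..d}" r] cont_along(3) \<open>b < d\<close> by force
  \<comment> \<open>For |w| < \<epsilon> the radial displacement stays below the least radius
    \<open>r t0\<close>, so the displaced path keeps clear of the origin; the 1 keeps the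
    denominator positive.\<close>
  define \<epsilon> where "\<epsilon> = r t0 / (\<bar>M\<bar> + 1)"
  define I where "I = {-\<epsilon><..<\<epsilon>}"
  have \<epsilon>: "0 < \<epsilon>" using r_pos by (simp add: \<epsilon>_def add_nonneg_pos)
  have I: "open I" "convex I" "0 \<in> I" using \<epsilon> by (auto simp: I_def)
  have pos: "0 < r t + w * ?\<rho> t" if "t \<in> {b..d}" "w \<in> I" for t w
  proof -
    have "\<bar>w * ?\<rho> t\<bar> \<le> \<bar>w\<bar> * (\<bar>M\<bar> + 1)"
      using M[OF that(1)] unfolding abs_mult by (intro mult_left_mono) auto
    also have "\<dots> < \<epsilon> * (\<bar>M\<bar> + 1)"
      using that(2) by (intro mult_strict_right_mono) (auto simp: I_def)
    also have "\<dots> = r t0" by (simp add: \<epsilon>_def)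
    finally show ?thesis using t0[OF that(1)] by linarith
  qed
  have v: "has_weak_deriv x v b d" and v_cont: "continuous_on {b..d} v"
  proof -
    show "continuous_on {b..d} v"
      using v_deriv by (meson continuous_at_imp_continuous_on has_vector_derivative_continuous)
    then show "has_weak_deriv x v b d" by (intro has_weak_deriv_C1 x_deriv)
  qed
  \<comment> \<open>The Leibniz rule asks for joint continuity in (w, t), so functions of t alone
    are pulled back along the second projection.\<close>
  have snd_cont: "continuous_on (S \<times> {b..d}) (\<lambda>z. f (snd z))" if "continuous_on {b..d} f"
    for f :: "real \<Rightarrow> real" and S :: "real set"
    by (rule continuous_on_compose2[OF that]) (auto intro: continuous_intros)
  note cont2 = snd_cont[OF cont(1)] snd_cont[OF cont(2)] snd_cont[OF cont_along(3)] snd_cont[OF theta_cont]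
  have pos2: "r (snd z) + fst z * ?\<rho> (snd z) \<noteq> 0"
    "0 < nsq (snd z) (?\<rho> (snd z)) (?\<sigma> (snd z)) (fst z)" if "z \<in> I \<times> {b..d}" for z
    using pos[of "snd z" "fst z"] nsq_pos that by auto
  have nsq2: "continuous_on (I \<times> {b..d}) (\<lambda>z. nsq (snd z) (?\<rho> (snd z)) (?\<sigma> (snd z)) (fst z))"
    unfolding nsq_def by (intro continuous_intros cont2)
  have hz2: "continuous_on (I \<times> {b..d}) (\<lambda>z. hz (snd z) (?\<rho> (snd z)) (?\<sigma> (snd z)) (fst z))"
    unfolding hz_def by (intro continuous_intros cont2)
  have ang2: "continuous_on (I \<times> {b..d}) (\<lambda>z. ang (snd z) (?\<rho> (snd z)) (?\<sigma> (snd z)) (fst z))"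
    unfolding ang_def by (intro continuous_intros cont2 ballI pos2)
  have W_ang2: "continuous_on (I \<times> {b..d}) (\<lambda>z. W (ang (snd z) (?\<rho> (snd z)) (?\<sigma> (snd z)) (fst z)))"
    "continuous_on (I \<times> {b..d}) (\<lambda>z. W1 (ang (snd z) (?\<rho> (snd z)) (?\<sigma> (snd z)) (fst z)))"
    "continuous_on (I \<times> {b..d}) (\<lambda>z. W2 (ang (snd z) (?\<rho> (snd z)) (?\<sigma> (snd z)) (fst z)))"
    by (auto intro: continuous_on_compose2[OF W_cont[of UNIV] ang2]
        continuous_on_compose2[OF W1_cont[of UNIV] ang2] continuous_on_compose2[OF W2_cont ang2])
  note cont3 = nsq2 hz2 W_ang2
  have G: "continuous_on (I \<times> {b..d}) (\<lambda>(w, t). G0 t (?\<rho> t) (?\<sigma> t) w)"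
    "continuous_on (I \<times> {b..d}) (\<lambda>(w, t). G1 t (?\<rho> t) (?\<sigma> t) w)"
    "continuous_on (I \<times> {b..d}) (\<lambda>(w, t). G2 t (?\<rho> t) (?\<sigma> t) w)"
    unfolding case_prod_unfold G0_def G1_def G2_def
    by (intro continuous_intros cont2 cont3; use pos2(2) in force)+
  have slice: "continuous_on {b..d} (\<lambda>t. f w t)" if "continuous_on (I \<times> {b..d}) (\<lambda>(w, t). f w t)" "w \<in> I"
    for f :: "real \<Rightarrow> real \<Rightarrow> real" and w
  proof -
    have "continuous_on {b..d} (\<lambda>t. (\<lambda>(w, t). f w t) (w, t))"
      by (rule continuous_on_compose2[OF that(1)]) (use that(2) in \<open>auto intro!: continuous_intros\<close>)
    then show ?thesis by simp
  qed
  note Gw = slice[OF G(1)] slice[OF G(2)] slice[OF G(3)]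
  have D0: "((\<lambda>w. integral {b..d} (\<lambda>t. G0 t (?\<rho> t) (?\<sigma> t) w)) has_real_derivative
      integral {b..d} (\<lambda>t. G1 t (?\<rho> t) (?\<sigma> t) w)) (at w)" if w: "w \<in> I" for w
    by (rule DERIV_integral_parameter[OF I(1,2) w _ Gw(1) G(2)])
       (auto intro!: G0_deriv pos)
  have D1: "((\<lambda>w. integral {b..d} (\<lambda>t. G1 t (?\<rho> t) (?\<sigma> t) w)) has_real_derivative
      integral {b..d} (\<lambda>t. G2 t (?\<rho> t) (?\<sigma> t) w)) (at w)" if w: "w \<in> I" for w
    by (rule DERIV_integral_parameter[OF I(1,2) w _ Gw(2) G(3)])
       (auto intro!: G1_deriv pos)
  let ?U = "potential \<alpha> V"
  define A0 where "A0 = (LINT t:{b..d}|lborel. (norm (v t))\<^sup>2) / 2"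
  define A1 where "A1 = (LINT t:{b..d}|lborel. v t \<bullet> g t)"
  define A2 where "A2 = (LINT t:{b..d}|lborel. (norm (g t))\<^sup>2)"
  have \<Phi>: "action ?U b d (\<lambda>t. x t + w *\<^sub>R h t) =
      A0 + w * A1 + w\<^sup>2 / 2 * A2 + integral {b..d} (\<lambda>t. G0 t (?\<rho> t) (?\<sigma> t) w)" if w: "w \<in> I" for w
  proof -
    have eq: "?U (x t + w *\<^sub>R h t) = G0 t (?\<rho> t) (?\<sigma> t) w" if "t \<in> {b..d}" for t
      by (rule potential_G0[OF pos[OF that w]])
    have "continuous_on {b..d} (\<lambda>t. ?U (x t + w *\<^sub>R h t))"
      by (rule continuous_on_eq[OF Gw(1)[OF w]]) (simp add: eq)
    moreover have "integral {b..d} (\<lambda>t. ?U (x t + w *\<^sub>R h t)) = integral {b..d} (\<lambda>t. G0 t (?\<rho> t) (?\<sigma> t) w)"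
      using eq by (intro integral_cong) auto
    ultimately show ?thesis
      using \<open>b < d\<close> by (simp add: action_perturb[OF v v_cont g] A0_def A1_def A2_def)
  qed
  \<comment> \<open>The path depends on s and u only through s + u, so the derivative at u = 0 is
    that of the one-parameter action at w = s.\<close>
  have inner: "deriv (\<lambda>u. action ?U b d (\<lambda>t. x t + s *\<^sub>R h t + u *\<^sub>R h t)) 0
      = A1 + s * A2 + integral {b..d} (\<lambda>t. G1 t (?\<rho> t) (?\<sigma> t) s)" if s: "s \<in> I" for s
  proof (rule DERIV_imp_deriv)
    have "((\<lambda>w. A0 + w * A1 + w\<^sup>2 / 2 * A2 + integral {b..d} (\<lambda>t. G0 t (?\<rho> t) (?\<sigma> t) w)) has_real_derivative
        A1 + s * A2 + integral {b..d} (\<lambda>t. G1 t (?\<rho> t) (?\<sigma> t) s)) (at s)"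
      by (auto intro!: derivative_eq_intros D0[OF s])
    then have "((\<lambda>w. action ?U b d (\<lambda>t. x t + w *\<^sub>R h t)) has_real_derivative
        A1 + s * A2 + integral {b..d} (\<lambda>t. G1 t (?\<rho> t) (?\<sigma> t) s)) (at s)"
      by (rule has_field_derivative_transform_within_open[OF _ I(1) s]) (simp add: \<Phi>)
    then show "((\<lambda>u. action ?U b d (\<lambda>t. x t + s *\<^sub>R h t + u *\<^sub>R h t)) has_real_derivative
        A1 + s * A2 + integral {b..d} (\<lambda>t. G1 t (?\<rho> t) (?\<sigma> t) s)) (at 0)"
      using DERIV_shift[of "\<lambda>w. action ?U b d (\<lambda>t. x t + w *\<^sub>R h t)" _ 0 s]
      by (simp add: scaleR_add_left ac_simps)
  qed
  have "((\<lambda>s. A1 + s * A2 + integral {b..d} (\<lambda>t. G1 t (?\<rho> t) (?\<sigma> t) s)) has_real_derivative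
      A2 + integral {b..d} (\<lambda>t. G2 t (?\<rho> t) (?\<sigma> t) 0)) (at 0)"
    by (auto intro!: derivative_eq_intros D1[OF I(3)])
  then have "((\<lambda>s. deriv (\<lambda>u. action ?U b d (\<lambda>t. x t + s *\<^sub>R h t + u *\<^sub>R h t)) 0) has_real_derivative
      A2 + integral {b..d} (\<lambda>t. G2 t (?\<rho> t) (?\<sigma> t) 0)) (at 0)"
    by (rule has_field_derivative_transform_within_open[OF _ I(1) I(3)]) (simp add: inner)
  then have "action_deriv2 ?U b d x h h = A2 + integral {b..d} (\<lambda>t. G2 t (?\<rho> t) (?\<sigma> t) 0)"
    unfolding action_deriv2_def by (rule DERIV_imp_deriv)
  also have "\<dots> = A2 + (LINT t:{b..d}|lborel. hess t (?\<rho> t) (?\<sigma> t))"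
    using borel_integrable_atLeastAtMost'[OF Gw(3)[OF I(3)]]
    by (simp add: set_borel_integral_eq_integral(2) G2_zero)
  also have "0 \<le> \<dots>"
    unfolding A2_def using second_variation_nonneg[OF g h0] \<open>b < d\<close> by simp
  finally show ?thesis .
qed

section \<open>Vanishing of the Morse index\<close>

lemma morse_index_on_zero:
  assumes "b < d"
  shows "morse_index_on (potential \<alpha> V) x b d = 0"
proof -
  have "curves.dim E = 0" if "curves.subspace E" "E \<subseteq> W0 b d"
    "negative_definite_on E (action_deriv2 (potential \<alpha> V) b d x)" for E
  proof -
    \<comment> \<open>A nonzero element would need a negative second variation, which
      \<open>action_deriv2_nonneg\<close> excludes.\<close>
    have "E \<subseteq> {0}"
      using that(2,3) action_deriv2_nonneg[OF _ assms] by (fastforce simp: negative_definite_on_def)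
    then show ?thesis
      by (metis curves.dim_eq_card curves.independent_empty card.empty curves.span_empty curves.dim_span subset_singletonD)
  qed
  then have "morse_index_on (potential \<alpha> V) x b d \<le> 0"
    unfolding morse_index_on_def by (intro Sup_least) (auto simp: zero_enat_def simp del: curves.dim_span)
  then show ?thesis by simp
qed

lemma has_morse_index_zero: "has_morse_index (potential \<alpha> V) x 0"
  by (simp add: has_morse_index_def morse_index_on_zero)

end

theorem corollary1p1:
  fixes \<alpha> :: real
    and V :: "real^2 \<Rightarrow> real"
    and x :: "real \<Rightarrow> real^2"
    and r \<theta> :: "real \<Rightarrow> real"
    and \<theta>m \<theta>p :: real
  assumes "0 < \<alpha>" and "\<alpha> < 2"
    and "C2_on_circle V"
    and "\<And>z. z \<in> sphere 0 1 \<Longrightarrow> V z > 0"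
    and "parabolic_solution (potential \<alpha> V) x"
    and "polar_coordinates x r \<theta>"
    and "(\<theta> \<longlongrightarrow> \<theta>m) at_bot"
    and "(\<theta> \<longlongrightarrow> \<theta>p) at_top"
    and "nondegenerate_global_minimizer V \<theta>m"
    and "nondegenerate_global_minimizer V \<theta>p"
  shows "has_morse_index (potential \<alpha> V) x 0 \<and> oscillation_index \<theta> = 0"
proof -
  obtain v a where sol: "\<And>t. (x has_vector_derivative v t) (at t)"
    "\<And>t. (v has_vector_derivative a t) (at t)" "\<And>t. GDERIV (potential \<alpha> V) (x t) :> a t"
    using assms(5) by (auto simp: parabolic_solution_def global_solution_def)
  \<comment> \<open>The decay of the velocity is assumed for \<open>vector_derivative\<close>,
    whereas the locale speaks of \<open>v\<close>.\<close>
  have "vector_derivative x (at t) = v t" for t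
    using sol(1) by (rule vector_derivative_at)
  with assms sol interpret kepler_parabolic \<alpha> V x v a r \<theta> \<theta>m \<theta>p
    by unfold_locales (auto simp: parabolic_solution_def nondegenerate_global_minimizer_def)
  show ?thesis using has_morse_index_zero oscillation_index_zero by blast
qed

end
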